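(* Let $q$ be a real-valued, $1$-periodic function with $q\in L_1[0,1]$ and $\int_0^1 q(x)\,dx=0$, and let $\mu_{n,1}\le\mu_{n,2}$ be its large antiperiodic eigenvalues. (a) If $q_{2n+1}=o(n^{-1})$ as $n\to\infty$, then $\mu_{n,j}=(2\pi n+\pi)^2+o(n^{-1})$ for $j=1,2$. (b) Let $\varepsilon>0$ be fixed, let $N$ be a sufficiently large positive integer, and let $\mathbb N_2(\varepsilon)$ be the set of all $n\in\mathbb N$ with $n>N$ and $|q_{2n+1}|\ge\frac{\varepsilon}{n}$. Then the eigenvalues $\mu_{n,j}$ for $n\in\mathbb N_2(\varepsilon)$ and $j=1,2$ are simple and satisfy $$\mu_{n,j}=(2\pi n+\pi)^2+(-1)^j|q_{2n+1}|+o(n^{-1})$$ as $n\to\infty$, $n\in\mathbb N_2(\varepsilon)$.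
   Context: $L_\pi(q)$ is the operator in $L_2[0,1]$ generated by $-y''+qy$ with antiperiodic boundary conditions $y(1)=-y(0)$, $y'(1)=-y'(0)$. Its large eigenvalues, counted with multiplicity, form two sequences $\mu_{n,1}\le\mu_{n,2}$ ($n\ge N_0$, $N_0$ a sufficiently large integer) with $\mu_{n,j}=(2\pi n+\pi)^2+O(n^{1/2})$. The Fourier coefficients are $q_k=\int_0^1q(x)e^{-i2\pi kx}dx$. How large $N$ must be may depend on $q$ and $\varepsilon$. *)

theory Defs
  imports "HOL-Analysis.Analysis" "HOL-Library.Landau_Symbols" "HOL-Library.Function_Algebras"
begin

definition fourier_coeff :: "(real \<Rightarrow> real) \<Rightarrow> int \<Rightarrow> complex" where
  "fourier_coeff q k =
     integral {0..1} (\<lambda>x. complex_of_real (q x) * exp (- (\<i> * 2 * of_real pi * of_int k * of_real x)))"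

(* f is absolutely continuous on [0,1] with almost everywhere derivative g, i.e. f is an
   indefinite Lebesgue integral of g in L_1[0,1]; "integral" agrees with the Lebesgue
   integral here because g is absolutely integrable. *)
definition abs_cont_with_deriv :: "(real \<Rightarrow> complex) \<Rightarrow> (real \<Rightarrow> complex) \<Rightarrow> bool" where
  "abs_cont_with_deriv f g \<longleftrightarrow>
     g absolutely_integrable_on {0..1} \<and> (\<forall>x\<in>{0..1}. f x = f 0 + integral {0..x} g)"

definition L2_01 :: "(real \<Rightarrow> complex) set" where
  "L2_01 = {f. set_borel_measurable lebesgue {0..1} f \<and>
               (\<lambda>x. (cmod (f x))\<^sup>2) absolutely_integrable_on {0..1}}"

(* The graph of the operator generated in L_2[0,1] by -y'' + q y: y lies in its domain and is
   mapped to f. Here y1 = y' and y2 = y''; y is represented by its continuous version. *)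
definition antiperiodic_op :: "(real \<Rightarrow> real) \<Rightarrow> (real \<Rightarrow> complex) \<Rightarrow> (real \<Rightarrow> complex) \<Rightarrow> bool" where
  "antiperiodic_op q y f \<longleftrightarrow>
     y \<in> L2_01 \<and> f \<in> L2_01 \<and>
     (\<exists>y1 y2. (\<forall>x\<in>{0..1}. (y has_vector_derivative y1 x) (at x within {0..1})) \<and>
        abs_cont_with_deriv y1 y2 \<and>
        y 1 = - y 0 \<and> y1 1 = - y1 0 \<and>
        (AE x in lebesgue. x \<in> {0..1} \<longrightarrow> f x = - y2 x + of_real (q x) * y x))"

(* Functions on [0,1] are extended by 0, so that distinct elements of this set are
   distinct elements of L_2[0,1] and the dimension below is the right one. *)
definition eigenspace :: "(real \<Rightarrow> real) \<Rightarrow> complex \<Rightarrow> (real \<Rightarrow> complex) set" where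
  "eigenspace q lam =
     {y. (\<forall>x. x \<notin> {0..1} \<longrightarrow> y x = 0) \<and> antiperiodic_op q y (\<lambda>x. lam * y x)}"

interpretation cfun: vector_space "\<lambda>(c::complex) (f::real \<Rightarrow> complex) x. c * f x"
  by unfold_locales (simp_all add: fun_eq_iff algebra_simps)

(* Geometric multiplicity; for real q the operator is self-adjoint, so it is also the algebraic one. *)
definition multiplicity_ev :: "(real \<Rightarrow> real) \<Rightarrow> complex \<Rightarrow> nat" where
  "multiplicity_ev q lam = cfun.dim (eigenspace q lam)"

definition is_eigenvalue :: "(real \<Rightarrow> real) \<Rightarrow> complex \<Rightarrow> bool" where
  "is_eigenvalue q lam \<longleftrightarrow> (\<exists>y\<in>eigenspace q lam. y \<noteq> 0)"

definition simple_eigenvalue :: "(real \<Rightarrow> real) \<Rightarrow> complex \<Rightarrow> bool" where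
  "simple_eigenvalue q lam \<longleftrightarrow> is_eigenvalue q lam \<and> multiplicity_ev q lam = 1"

(* mu n j, for n >= N0 and j = 1, 2, lists the eigenvalues outside some disc, each as often
   as its multiplicity, and is localised near (2 pi n + pi)^2. *)
definition large_eigenvalues :: "(real \<Rightarrow> real) \<Rightarrow> nat \<Rightarrow> (nat \<Rightarrow> nat \<Rightarrow> real) \<Rightarrow> bool" where
  "large_eigenvalues q N0 mu \<longleftrightarrow>
     (\<forall>n\<ge>N0. mu n 1 \<le> mu n 2) \<and>
     (\<forall>n\<ge>N0. \<forall>j\<in>{1,2}. is_eigenvalue q (of_real (mu n j))) \<and>
     (\<exists>R. \<forall>lam. card {(n, j). N0 \<le> n \<and> j \<in> {1,2} \<and> complex_of_real (mu n j) = lam} =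
                 (if R < cmod lam then multiplicity_ev q lam else 0)) \<and>
     (\<forall>j\<in>{1,2}. (\<lambda>n. mu n j - (2 * pi * real n + pi)\<^sup>2) \<in> O(\<lambda>n. sqrt (real n)))"

definition N2_set :: "(real \<Rightarrow> real) \<Rightarrow> real \<Rightarrow> nat \<Rightarrow> nat set" where
  "N2_set q \<epsilon> N = {n. n > N \<and> cmod (fourier_coeff q (2 * int n + 1)) \<ge> \<epsilon> / real n}"

end

theory Submission
  imports Defs
begin

text \<open>
Write \<open>s = (2 n + 1) \<pi>\<close> and let \<open>y\<close> be an antiperiodic eigenfunction for the eigenvalue \<open>s\<^sup>2 + \<delta>\<close>. With
\<open>p = q - \<delta>\<close> the equation becomes \<open>y'' + s\<^sup>2 y = p y\<close>. Variation of constants gives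
\<open>y = a exp(i s x) + b exp(- i s x)\<close>, where
\<open>a' = p y exp(- i s x) / (2 i s)\<close> and similarly for \<open>b\<close>. Since \<open>s\<close> is an odd multiple of \<open>\<pi>\<close>, the
antiperiodic boundary conditions say exactly that \<open>a\<close> and \<open>b\<close> are periodic, so \<open>a'\<close> and \<open>b'\<close> have mean
zero. To first order \<open>a\<close> and \<open>b\<close> are constant, and these two mean value conditions read
\<open>\<delta> a = c b\<close> and \<open>\<delta> b = cnj c a\<close>, where \<open>c\<close> is the Fourier coefficient of \<open>q\<close> with index \<open>2 n + 1\<close>. So \<open>\<delta>\<close> is
to first order an eigenvalue \<open>\<plusminus> \<bar>c\<bar>\<close> of a Hermitian matrix of size two.

What has to be shown is that the error in these equations is \<open>o(1 / n)\<close> and not only \<open>O(1 / n)\<close>. The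
terms of order \<open>1 / n\<close> are double integrals of \<open>p\<close> against primitives of \<open>p\<close>, \<open>p exp(2 i s x)\<close>
and \<open>p exp(- 2 i s x)\<close>. A primitive with an oscillating factor is uniformly small by the Riemann-Lebesgue
lemma (\<open>riemann_lebesgue_uniform\<close>), and the one term without such a factor is
\<open>\<integral> p P = \<delta>\<^sup>2 / 2\<close> for the primitive \<open>P\<close> of \<open>p\<close>, because \<open>q\<close> has mean zero. A cruder version of the same
argument (\<open>delta_bound\<close>) first shows \<open>\<delta> \<rightarrow> 0\<close>. The outcome is \<open>secular_refined\<close>, and
\<open>asymptotic_secular\<close> in quantified form.

Consequently \<open>\<bar>\<delta>\<bar> = \<bar>c\<bar> + o(1 / n)\<close>, which settles the case \<open>c = o(1 / n)\<close>. If \<open>\<bar>c\<bar> \<ge> \<epsilon> / n\<close>, then a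
two-dimensional eigenspace is impossible, since the amplitudes \<open>(1, 0)\<close> violate the second equation
(\<open>eigenvalue_simple\<close>). The list of eigenvalues respects multiplicities, so the two simple eigenvalues
with index \<open>n\<close> are distinct and their eigenfunctions orthogonal. On the same branch
the amplitude vectors would be nearly parallel; hence one eigenvalue follows \<open>- \<bar>c\<bar>\<close> and the other
\<open>\<bar>c\<bar>\<close> (\<open>opposite_signs_of_near_orthogonal\<close>).
\<close>

section \<open>Calculus of absolutely continuous functions\<close>

lemma absolutely_integrable_mult_continuous:
  fixes f g :: "real \<Rightarrow> complex"
  assumes f: "f absolutely_integrable_on {0..1}" and g: "continuous_on {0..1} g"
  shows "(\<lambda>x. f x * g x) absolutely_integrable_on {0..1}"
proof -
  have "(\<lambda>x. g x * f x) absolutely_integrable_on {0..1}"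
  proof (rule absolutely_integrable_bounded_measurable_product[OF bilinear_times _ _ _ f])
    show "g \<in> borel_measurable (lebesgue_on {0..1})"
      by (rule continuous_imp_measurable_on_sets_lebesgue[OF g]) auto
    show "bounded (g ` {0..1})"
      using compact_continuous_image[OF g] compact_imp_bounded by auto
  qed auto
  then show ?thesis by (simp add: mult.commute)
qed

lemma abs_cont_integrable:
  "abs_cont_with_deriv f g \<Longrightarrow> g absolutely_integrable_on {0..1}"
  unfolding abs_cont_with_deriv_def by blast

lemma abs_cont_integral:
  assumes "abs_cont_with_deriv f g" "0 \<le> u" "u \<le> v" "v \<le> 1"
  shows "(g has_integral f v - f u) {u..v}"
proof -
  have g: "g absolutely_integrable_on {0..1}"
    and f: "\<And>x. x \<in> {0..1} \<Longrightarrow> f x = f 0 + integral {0..x} g"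
    using assms(1) unfolding abs_cont_with_deriv_def by blast+
  have gi: "g integrable_on {0..1}"
    using g absolutely_integrable_on_def by blast
  have gv: "g integrable_on {0..v}" and guv: "g integrable_on {u..v}"
    using assms by (auto intro: integrable_on_subinterval[OF gi])
  have "integral {u..v} g = f v - f u"
    using Henstock_Kurzweil_Integration.integral_combine[of 0 u v g] f[of u] f[of v] gv assms
    by (simp add: algebra_simps)
  then show ?thesis
    using integrable_integral[OF guv] by simp
qed

lemma abs_cont_continuous:
  assumes "abs_cont_with_deriv f g"
  shows "continuous_on {0..1} f"
proof -
  have g: "g integrable_on {0..1}"
    and f: "\<And>x. x \<in> {0..1} \<Longrightarrow> f x = f 0 + integral {0..x} g"
    using assms unfolding abs_cont_with_deriv_def absolutely_integrable_on_def by blast+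
  have "continuous_on {0..1} (\<lambda>x. f 0 + integral {0..x} g)"
    by (intro continuous_intros indefinite_integral_continuous_1 g)
  then show ?thesis
    by (rule continuous_on_eq) (simp add: f[symmetric])
qed

lemma abs_contI:
  assumes "g absolutely_integrable_on {0..1}"
    and "\<And>x. 0 \<le> x \<Longrightarrow> x \<le> 1 \<Longrightarrow> (g has_integral f x - f 0) {0..x}"
  shows "abs_cont_with_deriv f g"
  unfolding abs_cont_with_deriv_def
proof (intro conjI ballI)
  fix x :: real assume "x \<in> {0..1}"
  then show "f x = f 0 + integral {0..x} g"
    using integral_unique[OF assms(2)[of x]] by simp
qed (rule assms(1))

lemma abs_cont_indefinite_integral:
  assumes "g absolutely_integrable_on {0..1}"
  shows "abs_cont_with_deriv (\<lambda>x. integral {0..x} g) g"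
  using assms by (auto simp: abs_cont_with_deriv_def)

lemma abs_cont_C1:
  assumes "\<And>x. x \<in> {0..1} \<Longrightarrow> (f has_vector_derivative g x) (at x within {0..1})"
    and "continuous_on {0..1} g"
  shows "abs_cont_with_deriv f g"
proof (rule abs_contI)
  show "g absolutely_integrable_on {0..1}"
    by (rule absolutely_integrable_continuous_real[OF assms(2)])
  fix x :: real assume "0 \<le> x" "x \<le> 1"
  then show "(g has_integral f x - f 0) {0..x}"
    by (intro fundamental_theorem_of_calculus)
      (auto intro: has_vector_derivative_within_subset[OF assms(1)])
qed

lemma abs_cont_cong:
  assumes "abs_cont_with_deriv f g" "\<And>x. x \<in> {0..1} \<Longrightarrow> f x = f' x" "\<And>x. x \<in> {0..1} \<Longrightarrow> g x = g' x"
  shows "abs_cont_with_deriv f' g'"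
proof (rule abs_contI)
  have "g absolutely_integrable_on {0..1}"
    using assms(1) by (rule abs_cont_integrable)
  then show "g' absolutely_integrable_on {0..1}"
    by (rule absolutely_integrable_spike[where S="{}"]) (use assms in auto)
  fix x :: real assume x: "0 \<le> x" "x \<le> 1"
  have "(g has_integral f x - f 0) {0..x}"
    using abs_cont_integral[OF assms(1), of 0 x] x by auto
  moreover have "f x = f' x" "f 0 = f' 0"
    using assms(2) x by auto
  ultimately have "(g has_integral f' x - f' 0) {0..x}" by simp
  then show "(g' has_integral f' x - f' 0) {0..x}"
    by (rule has_integral_eq[rotated]) (use assms(3) x in auto)
qed

lemma abs_cont_cong_AE:
  assumes "abs_cont_with_deriv f g" "h absolutely_integrable_on {0..1}"
    and "AE x in lebesgue. x \<in> {0..1} \<longrightarrow> g x = h x"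
  shows "abs_cont_with_deriv f h"
proof (rule abs_contI)
  obtain N where N: "N \<in> null_sets lebesgue" "{x. \<not> (x \<in> {0..1} \<longrightarrow> g x = h x)} \<subseteq> N"
    using assms(3) by (auto simp: eventually_ae_filter)
  fix x :: real assume x: "0 \<le> x" "x \<le> 1"
  have *: "(g has_integral f x - f 0) {0..x}"
    using abs_cont_integral[OF assms(1), of 0 x] x by auto
  show "(h has_integral f x - f 0) {0..x}"
  proof (rule has_integral_spike[OF _ _ *])
    show "negligible N" using N(1) by (simp add: negligible_iff_null_sets)
    fix t assume that: "t \<in> {0..x} - N"
    show "h t = g t"
    proof -
      have "t \<in> {0..1}" "t \<notin> N" using that x by auto
      then show ?thesis using N(2) by fastforce
    qed
  qed
qed (rule assms(2))

lemma abs_cont_add: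
  assumes "abs_cont_with_deriv f f'" "abs_cont_with_deriv g g'"
  shows "abs_cont_with_deriv (\<lambda>x. f x + g x) (\<lambda>x. f' x + g' x)"
proof (rule abs_contI)
  show "(\<lambda>x. f' x + g' x) absolutely_integrable_on {0..1}"
    using assms by (simp add: abs_cont_integrable)
  fix x :: real assume "0 \<le> x" "x \<le> 1"
  then show "((\<lambda>x. f' x + g' x) has_integral (f x + g x) - (f 0 + g 0)) {0..x}"
    using has_integral_add[OF abs_cont_integral[OF assms(1), of 0 x] abs_cont_integral[OF assms(2), of 0 x]]
    by (simp add: algebra_simps)
qed

lemma abs_cont_cmult:
  assumes "abs_cont_with_deriv f f'"
  shows "abs_cont_with_deriv (\<lambda>x. c * f x) (\<lambda>x. c * f' x)"
proof (rule abs_contI)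
  have "(\<lambda>x. f' x * c) absolutely_integrable_on {0..1}"
    using assms by (intro absolutely_integrable_mult_continuous) (auto simp: abs_cont_integrable)
  then show "(\<lambda>x. c * f' x) absolutely_integrable_on {0..1}"
    by (simp add: mult.commute)
  fix x :: real assume "0 \<le> x" "x \<le> 1"
  then show "((\<lambda>x. c * f' x) has_integral (c * f x) - (c * f 0)) {0..x}"
    using has_integral_mult_right[OF abs_cont_integral[OF assms, of 0 x], of c]
    by (simp add: algebra_simps)
qed

lemma abs_cont_cnj:
  assumes "abs_cont_with_deriv f f'"
  shows "abs_cont_with_deriv (\<lambda>x. cnj (f x)) (\<lambda>x. cnj (f' x))"
proof (rule abs_contI)
  show "(\<lambda>x. cnj (f' x)) absolutely_integrable_on {0..1}"
    using absolutely_integrable_linear[OF abs_cont_integrable[OF assms] bounded_linear_cnj]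
    by (simp add: o_def)
  fix x :: real assume "0 \<le> x" "x \<le> 1"
  then show "((\<lambda>x. cnj (f' x)) has_integral (cnj (f x)) - (cnj (f 0))) {0..x}"
    using has_integral_cnj[of f' "f x - f 0" "{0..x}"] abs_cont_integral[OF assms, of 0 x]
    by (simp add: o_def)
qed

lemma integral_norm_mult_le:
  fixes f g :: "real \<Rightarrow> complex"
  assumes f: "f absolutely_integrable_on {0..1}" and g: "continuous_on {0..1} g"
    and B: "\<And>x. x \<in> {u..v} \<Longrightarrow> cmod (g x) \<le> B" and uv: "0 \<le> u" "u \<le> v" "v \<le> 1"
  shows "cmod (integral {u..v} (\<lambda>x. f x * g x)) \<le> B * integral {u..v} (\<lambda>x. cmod (f x))"
proof -
  have sub: "{u..v} \<subseteq> {0..1}" using uv by auto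
  have fi: "(\<lambda>x. cmod (f x)) integrable_on {u..v}"
    using f sub uv unfolding absolutely_integrable_on_def by (auto intro: integrable_on_subinterval)
  have "(\<lambda>x. f x * g x) integrable_on {u..v}"
    using absolutely_integrable_mult_continuous[OF f g] sub
    unfolding absolutely_integrable_on_def by (auto intro: integrable_on_subinterval)
  moreover have "(\<lambda>x. B * cmod (f x)) integrable_on {u..v}"
    using fi by (rule integrable_on_mult_right)
  ultimately have "cmod (integral {u..v} (\<lambda>x. f x * g x)) \<le> integral {u..v} (\<lambda>x. B * cmod (f x))"
    using B by (intro integral_norm_bound_integral)
      (auto simp: norm_mult mult.commute[of _ "cmod (f _)"] intro!: mult_left_mono)
  then show ?thesis by simp
qed

text \<open>Absolutely continuous functions have derivatives only almost everywhere, so the usual argument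
by differentiation is replaced by this one: an increment that is, on every short interval, an
arbitrarily small multiple of the increment of a fixed function \<open>\<Phi>\<close> must vanish, because the bounds
add up along a fine partition to \<open>\<epsilon> * (\<Phi> x - \<Phi> 0)\<close>.\<close>

lemma zero_increments_of_local_bound:
  fixes H :: "real \<Rightarrow> complex" and \<Phi> :: "real \<Rightarrow> real"
  assumes loc: "\<And>\<epsilon>. \<epsilon> > 0 \<Longrightarrow> \<exists>d>0. \<forall>u v. 0 \<le> u \<and> u \<le> v \<and> v \<le> 1 \<and> v - u < d \<longrightarrow>
                   cmod (H v - H u) \<le> \<epsilon> * (\<Phi> v - \<Phi> u)"
    and x: "0 \<le> x" "x \<le> 1"
  shows "H x = H 0"
proof -
  have bound: "cmod (H x - H 0) \<le> \<epsilon> * (\<Phi> x - \<Phi> 0)" if \<epsilon>: "\<epsilon> > 0" for \<epsilon>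
  proof -
    obtain d where d: "d > 0" and H: "\<And>u v. 0 \<le> u \<Longrightarrow> u \<le> v \<Longrightarrow> v \<le> 1 \<Longrightarrow> v - u < d \<Longrightarrow>
                   cmod (H v - H u) \<le> \<epsilon> * (\<Phi> v - \<Phi> u)"
      using loc[OF \<epsilon>] by blast
    have step: "cmod (H v - H 0) \<le> \<epsilon> * (\<Phi> v - \<Phi> 0)"
      if "0 \<le> v" "v \<le> 1" "v \<le> real k * (d/2)" for k v
      using that
    proof (induction k arbitrary: v)
      case 0
      then show ?case by simp
    next
      case (Suc k)
      define u where "u = max 0 (v - d/2)"
      have u: "0 \<le> u" "u \<le> v" "v - u < d" "u \<le> real k * (d/2)"
        using Suc.prems d by (auto simp: u_def max_def field_simps)
      have "cmod (H u - H 0) \<le> \<epsilon> * (\<Phi> u - \<Phi> 0)"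
        using u Suc.prems by (intro Suc.IH) auto
      moreover have "cmod (H v - H u) \<le> \<epsilon> * (\<Phi> v - \<Phi> u)"
        using u Suc.prems by (intro H) auto
      moreover have "cmod (H v - H 0) \<le> cmod (H v - H u) + cmod (H u - H 0)"
        using norm_triangle_ineq[of "H v - H u" "H u - H 0"] by simp
      ultimately show ?case by (simp add: algebra_simps)
    qed
    obtain k :: nat where "1 / (d/2) < real k" using reals_Archimedean2 by blast
    then have "x \<le> real k * (d/2)" using d x by (simp add: field_simps)
    then show ?thesis using step x by blast
  qed
  have "\<Phi> x - \<Phi> 0 \<ge> 0"
    using order_trans[OF norm_ge_zero bound[of 1]] by simp
  then have "cmod (H x - H 0) \<le> 0"
  proof (cases "\<Phi> x - \<Phi> 0 = 0")
    case True
    then show ?thesis using bound[of 1] by simp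
  next
    case False
    then have pos: "\<Phi> x - \<Phi> 0 > 0" using \<open>\<Phi> x - \<Phi> 0 \<ge> 0\<close> by simp
    show ?thesis
    proof (rule field_le_epsilon)
      fix e :: real assume "e > 0"
      then show "cmod (H x - H 0) \<le> 0 + e"
        using bound[of "e / (\<Phi> x - \<Phi> 0)"] pos by simp
    qed
  qed
  then show ?thesis by simp
qed

text \<open>The product rule, and with it integration by parts for \<open>L\<^sub>1\<close> derivatives. Over \<open>[u, v]\<close> the defect
\<open>f v * g v - f u * g u - \<integral> (f' g + f g')\<close> equals \<open>\<integral> f' (g u - g) + \<integral> g' (f v - f)\<close>, and on short
intervals the oscillations of \<open>f\<close> and \<open>g\<close> are uniformly small; hence the defect has increments as
in \<open>zero_increments_of_local_bound\<close>.\<close>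

lemma abs_cont_mult:
  assumes f: "abs_cont_with_deriv f f'" and g: "abs_cont_with_deriv g g'"
  shows "abs_cont_with_deriv (\<lambda>x. f x * g x) (\<lambda>x. f' x * g x + f x * g' x)"
proof -
  have ai: "f' absolutely_integrable_on {0..1}" "g' absolutely_integrable_on {0..1}"
    using f g by (auto simp: abs_cont_integrable)
  note cf = abs_cont_continuous[OF f] and cg = abs_cont_continuous[OF g]
  have h1: "(\<lambda>x. f' x * g x) absolutely_integrable_on {0..1}"
    by (rule absolutely_integrable_mult_continuous[OF ai(1) cg])
  have h2: "(\<lambda>x. g' x * f x) absolutely_integrable_on {0..1}"
    by (rule absolutely_integrable_mult_continuous[OF ai(2) cf])
  have hai: "(\<lambda>x. f' x * g x + f x * g' x) absolutely_integrable_on {0..1}"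
    using h1 h2 by (simp add: mult.commute[of "f _"])
  define h where "h = (\<lambda>x. f' x * g x + f x * g' x)"
  have hi: "h integrable_on {u..v}" if "0 \<le> u" "v \<le> 1" for u v
    using hai that unfolding h_def absolutely_integrable_on_def
    by (auto intro: integrable_on_subinterval)
  have ni: "(\<lambda>x. cmod (f' x)) integrable_on {0..1}" "(\<lambda>x. cmod (g' x)) integrable_on {0..1}"
    using ai by (auto simp: absolutely_integrable_on_def)
  define \<Phi> where "\<Phi> x = integral {0..x} (\<lambda>x. cmod (f' x)) + integral {0..x} (\<lambda>x. cmod (g' x))" for x
  have \<Phi>: "\<Phi> v - \<Phi> u = integral {u..v} (\<lambda>x. cmod (f' x)) + integral {u..v} (\<lambda>x. cmod (g' x))"
    if "0 \<le> u" "u \<le> v" "v \<le> 1" for u v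
  proof -
    have "(\<lambda>x. cmod (f' x)) integrable_on {0..v}" "(\<lambda>x. cmod (g' x)) integrable_on {0..v}"
      using ni that by (auto intro: integrable_on_subinterval)
    then show ?thesis
      using Henstock_Kurzweil_Integration.integral_combine[of 0 u v "\<lambda>x. cmod (f' x)"]
        Henstock_Kurzweil_Integration.integral_combine[of 0 u v "\<lambda>x. cmod (g' x)"] that
      by (simp add: \<Phi>_def)
  qed
  define H where "H x = f x * g x - integral {0..x} h" for x
  have H0: "H x = H 0" if "0 \<le> x" "x \<le> 1" for x
  proof (rule zero_increments_of_local_bound[where \<Phi>=\<Phi>, OF _ that])
    fix \<epsilon> :: real assume \<epsilon>: "\<epsilon> > 0"
    obtain d1 where d1: "d1 > 0" "\<And>u v. u \<in> {0..1} \<Longrightarrow> v \<in> {0..1} \<Longrightarrow> dist v u < d1 \<Longrightarrow> dist (f v) (f u) < \<epsilon>"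
      using compact_uniformly_continuous[OF cf] \<epsilon> by (auto simp: uniformly_continuous_on_def)
    obtain d2 where d2: "d2 > 0" "\<And>u v. u \<in> {0..1} \<Longrightarrow> v \<in> {0..1} \<Longrightarrow> dist v u < d2 \<Longrightarrow> dist (g v) (g u) < \<epsilon>"
      using compact_uniformly_continuous[OF cg] \<epsilon> by (auto simp: uniformly_continuous_on_def)
    show "\<exists>d>0. \<forall>u v. 0 \<le> u \<and> u \<le> v \<and> v \<le> 1 \<and> v - u < d \<longrightarrow> cmod (H v - H u) \<le> \<epsilon> * (\<Phi> v - \<Phi> u)"
    proof (intro exI[of _ "min d1 d2"] conjI allI impI)
      show "min d1 d2 > 0" using d1 d2 by simp
      fix u v assume "0 \<le> u \<and> u \<le> v \<and> v \<le> 1 \<and> v - u < min d1 d2"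
      then have uv: "0 \<le> u" "u \<le> v" "v \<le> 1" "v - u < d1" "v - u < d2" by auto
      have F: "(f' has_integral f v - f u) {u..v}" and G: "(g' has_integral g v - g u) {u..v}"
        using abs_cont_integral f g uv by auto
      have hI: "(h has_integral integral {u..v} h) {u..v}"
        using hi uv by blast
      have Hd: "H v - H u = f v * g v - f u * g u - integral {u..v} h"
        using Henstock_Kurzweil_Integration.integral_combine[of 0 u v h] hi[of 0 v] uv
        by (simp add: H_def algebra_simps)
      have I1: "((\<lambda>x. f' x * (g u - g x) + g' x * (f v - f x)) has_integral H v - H u) {u..v}"
      proof -
        have "((\<lambda>x. (g u * f' x + f v * g' x) - h x) has_integral
                (g u * (f v - f u) + f v * (g v - g u)) - integral {u..v} h) {u..v}"
          by (intro has_integral_diff has_integral_add has_integral_mult_right F G hI)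
        then show ?thesis
          by (simp add: Hd h_def algebra_simps)
      qed
      have c1: "continuous_on {0..1} (\<lambda>x. g u - g x)" and c2: "continuous_on {0..1} (\<lambda>x. f v - f x)"
        by (intro continuous_intros cf cg)+
      have e1: "cmod (integral {u..v} (\<lambda>x. f' x * (g u - g x))) \<le> \<epsilon> * integral {u..v} (\<lambda>x. cmod (f' x))"
      proof (rule integral_norm_mult_le[OF ai(1) c1 _ uv(1-3)])
        show "cmod (g u - g x) \<le> \<epsilon>" if "x \<in> {u..v}" for x
          using d2(2)[of x u] that uv by (auto simp: dist_norm intro: less_imp_le)
      qed
      have e2: "cmod (integral {u..v} (\<lambda>x. g' x * (f v - f x))) \<le> \<epsilon> * integral {u..v} (\<lambda>x. cmod (g' x))"
      proof (rule integral_norm_mult_le[OF ai(2) c2 _ uv(1-3)])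
        show "cmod (f v - f x) \<le> \<epsilon>" if "x \<in> {u..v}" for x
          using d1(2)[of x v] that uv by (auto simp: dist_norm intro: less_imp_le)
      qed
      have i1: "(\<lambda>x. f' x * (g u - g x)) integrable_on {u..v}" "(\<lambda>x. g' x * (f v - f x)) integrable_on {u..v}"
        using absolutely_integrable_mult_continuous[OF ai(1) c1] absolutely_integrable_mult_continuous[OF ai(2) c2] uv
        unfolding absolutely_integrable_on_def
        by (auto intro!: integrable_on_subinterval[of _ "{0..1}"])
      have "H v - H u = integral {u..v} (\<lambda>x. f' x * (g u - g x)) + integral {u..v} (\<lambda>x. g' x * (f v - f x))"
        using I1 i1 by (simp add: integral_unique flip: Henstock_Kurzweil_Integration.integral_add)
      then have "cmod (H v - H u) \<le> \<epsilon> * integral {u..v} (\<lambda>x. cmod (f' x)) + \<epsilon> * integral {u..v} (\<lambda>x. cmod (g' x))"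
        using norm_triangle_mono[OF e1 e2] by simp
      then show "cmod (H v - H u) \<le> \<epsilon> * (\<Phi> v - \<Phi> u)"
        using \<Phi>[of u v] uv by (simp add: algebra_simps)
    qed
  qed
  show ?thesis
  proof (rule abs_contI[OF hai])
    fix x :: real assume x: "0 \<le> x" "x \<le> 1"
    have "integral {0..x} h = f x * g x - f 0 * g 0"
      using H0[OF x] by (simp add: H_def algebra_simps)
    then show "((\<lambda>x. f' x * g x + f x * g' x) has_integral f x * g x - f 0 * g 0) {0..x}"
      using integrable_integral[OF hi[of 0 x]] x by (simp add: h_def)
  qed
qed

section \<open>The Riemann-Lebesgue lemma\<close>

text \<open>A measurable function is an almost everywhere limit of continuous functions; truncating both at a
height \<open>k\<close> turns this into convergence in \<open>L\<^sub>1\<close> by dominated convergence.\<close>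

lemma L1_approx_continuous:
  fixes f :: "real \<Rightarrow> real"
  assumes f: "f absolutely_integrable_on {0..1}" and \<epsilon>: "\<epsilon> > 0"
  shows "\<exists>g. continuous_on {0..1} g \<and> integral {0..1} (\<lambda>x. \<bar>f x - g x\<bar>) < \<epsilon>"
proof -
  have fm: "f \<in> borel_measurable (lebesgue_on {0..1})"
    using f by (simp add: absolutely_integrable_measurable)
  then have "f measurable_on {0..1}"
    by (simp add: measurable_on_iff_borel_measurable)
  then obtain N g where N: "negligible N" and gc: "\<And>n. continuous_on UNIV (g n)"
    and glim: "\<And>x. x \<notin> N \<Longrightarrow> (\<lambda>n. g n x) \<longlonglongrightarrow> (if x \<in> {0..1} then f x else 0)"
    unfolding measurable_on_def by blast
  define c where "c k z = max (- real k) (min (real k) z)" for k :: nat and z :: real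
  have cc: "continuous_on S (c k)" for S k
    unfolding c_def by (intro continuous_intros)
  have cabs: "\<bar>c k z\<bar> \<le> real k" "\<bar>z - c k z\<bar> \<le> \<bar>z\<bar>" for k z
    by (auto simp: c_def)
  have cf: "(\<lambda>x. c k (f x)) absolutely_integrable_on {0..1}" for k
    using f by (auto simp: c_def intro!: absolutely_integrable_max_1 absolutely_integrable_min_1)
  have cg: "continuous_on {0..1} (\<lambda>x. c k (g n x))" for k n
    by (rule continuous_on_compose2[OF cc[of UNIV] continuous_on_subset[OF gc]]) auto
  have ai: "(\<lambda>x. \<bar>f x\<bar>) integrable_on {0..1}"
    using f by (simp add: absolutely_integrable_on_def)
  have i1: "(\<lambda>x. \<bar>f x - c k (f x)\<bar>) integrable_on {0..1}" for k
    using set_integral_diff(1)[OF f cf[of k]] by (simp add: absolutely_integrable_on_def)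
  have i2: "(\<lambda>x. \<bar>c k (f x) - c k (g n x)\<bar>) integrable_on {0..1}" for k n
    using set_integral_diff(1)[OF cf[of k] absolutely_integrable_continuous_real[OF cg[of k n]]]
    by (simp add: absolutely_integrable_on_def)
  have i3: "(\<lambda>x. \<bar>f x - c k (g n x)\<bar>) integrable_on {0..1}" for k n
    using set_integral_diff(1)[OF f absolutely_integrable_continuous_real[OF cg[of k n]]]
    by (simp add: absolutely_integrable_on_def)
  have "(\<lambda>k. integral {0..1} (\<lambda>x. \<bar>f x - c k (f x)\<bar>)) \<longlonglongrightarrow> integral {0..1::real} (\<lambda>x. 0::real)"
  proof (rule dominated_convergence(2)[where f="\<lambda>k x. \<bar>f x - c k (f x)\<bar>", OF i1 ai])
    show "norm \<bar>f x - c k (f x)\<bar> \<le> \<bar>f x\<bar>" for k x using cabs by simp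
    show "(\<lambda>k. \<bar>f x - c k (f x)\<bar>) \<longlonglongrightarrow> 0" for x
    proof (rule tendsto_eventually)
      obtain K :: nat where "\<bar>f x\<bar> < real K" using reals_Archimedean2 by blast
      then show "\<forall>\<^sub>F k in sequentially. \<bar>f x - c k (f x)\<bar> = 0"
        by (intro eventually_sequentiallyI[of K]) (auto simp: c_def)
    qed
  qed
  then have "\<forall>\<^sub>F k in sequentially. integral {0..1} (\<lambda>x. \<bar>f x - c k (f x)\<bar>) < \<epsilon> / 2"
    using \<epsilon> by (intro order_tendstoD) auto
  then obtain k where k: "integral {0..1} (\<lambda>x. \<bar>f x - c k (f x)\<bar>) < \<epsilon> / 2"
    using eventually_happens sequentially_bot by blast
  \<comment> \<open>The exceptional null set is removed, so that convergence holds at every point.\<close>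
  define h where "h n x = (if x \<in> N then 0 else \<bar>c k (f x) - c k (g n x)\<bar>)" for n x
  have hi: "h n integrable_on {0..1}" for n
    by (rule integrable_spike[OF i2[of k n] N]) (auto simp: h_def)
  have hint: "integral {0..1} (h n) = integral {0..1} (\<lambda>x. \<bar>c k (f x) - c k (g n x)\<bar>)" for n
    by (rule integral_spike[OF N]) (auto simp: h_def)
  have "(\<lambda>n. integral {0..1} (h n)) \<longlonglongrightarrow> integral {0..1::real} (\<lambda>x. 0::real)"
  proof (rule dominated_convergence(2)[where f=h, OF hi])
    show "(\<lambda>x. 2 * real k) integrable_on {0..1::real}" by auto
    show "norm (h n x) \<le> 2 * real k" for n x
      using cabs(1)[of k "f x"] cabs(1)[of k "g n x"] by (auto simp: h_def)
    show "(\<lambda>n. h n x) \<longlonglongrightarrow> 0" if "x \<in> {0..1}" for x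
    proof (cases "x \<in> N")
      case False
      have "(\<lambda>n. g n x) \<longlonglongrightarrow> f x" using glim[OF False] that by simp
      then have "(\<lambda>n. c k (g n x)) \<longlonglongrightarrow> c k (f x)"
        using cc[of UNIV k] continuous_on_tendsto_compose by fastforce
      then have "(\<lambda>n. \<bar>c k (f x) - c k (g n x)\<bar>) \<longlonglongrightarrow> \<bar>c k (f x) - c k (f x)\<bar>"
        by (intro tendsto_intros)
      then show ?thesis using False by (simp add: h_def)
    qed (simp add: h_def)
  qed
  then have "\<forall>\<^sub>F n in sequentially. integral {0..1} (h n) < \<epsilon> / 2"
    using \<epsilon> by (intro order_tendstoD) auto
  then obtain n where n: "integral {0..1} (h n) < \<epsilon> / 2"
    using eventually_happens sequentially_bot by blast
  have "integral {0..1} (\<lambda>x. \<bar>f x - c k (g n x)\<bar>)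
      \<le> integral {0..1} (\<lambda>x. \<bar>f x - c k (f x)\<bar> + \<bar>c k (f x) - c k (g n x)\<bar>)"
    by (intro integral_le i3 integrable_add i1 i2) auto
  also have "\<dots> = integral {0..1} (\<lambda>x. \<bar>f x - c k (f x)\<bar>) + integral {0..1} (h n)"
    unfolding hint by (intro Henstock_Kurzweil_Integration.integral_add i1 i2)
  also have "\<dots> < \<epsilon>" using k n by simp
  finally show ?thesis using cg by blast
qed

lemma L1_approx_C1:
  fixes f :: "real \<Rightarrow> real"
  assumes f: "f absolutely_integrable_on {0..1}" and \<epsilon>: "\<epsilon> > 0"
  shows "\<exists>p p'. (\<forall>x. (p has_real_derivative p' x) (at x)) \<and> continuous_on {0..1} p'
           \<and> integral {0..1} (\<lambda>x. \<bar>f x - p x\<bar>) < \<epsilon>"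
proof -
  obtain g where g: "continuous_on {0..1} g" "integral {0..1} (\<lambda>x. \<bar>f x - g x\<bar>) < \<epsilon> / 2"
    using L1_approx_continuous[OF f, of "\<epsilon>/2"] \<epsilon> by auto
  obtain p where p: "real_polynomial_function p" "\<And>x. x \<in> {0..1} \<Longrightarrow> \<bar>g x - p x\<bar> < \<epsilon> / 2"
    using Stone_Weierstrass_real_polynomial_function[OF _ g(1), of "\<epsilon>/2"] \<epsilon> by auto
  obtain p' where p': "real_polynomial_function p'" "\<forall>x. (p has_real_derivative p' x) (at x)"
    using has_real_derivative_polynomial_function[OF p(1)] by blast
  have pc: "continuous_on {0..1} p" "continuous_on {0..1} p'"
    using p p' by (auto intro!: continuous_on_polymonial_function simp: real_polynomial_function_eq)
  have i1: "(\<lambda>x. \<bar>f x - p x\<bar>) integrable_on {0..1}" "(\<lambda>x. \<bar>f x - g x\<bar>) integrable_on {0..1}"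
    using set_integral_diff(1)[OF f absolutely_integrable_continuous_real[OF pc(1)]]
      set_integral_diff(1)[OF f absolutely_integrable_continuous_real[OF g(1)]]
    by (auto simp: absolutely_integrable_on_def)
  have i2: "(\<lambda>x. \<epsilon>/2) integrable_on {0..1::real}" by auto
  have "integral {0..1} (\<lambda>x. \<bar>f x - p x\<bar>) \<le> integral {0..1} (\<lambda>x. \<bar>f x - g x\<bar> + \<epsilon>/2)"
  proof (intro integral_le i1 integrable_add i2)
    show "\<bar>f x - p x\<bar> \<le> \<bar>f x - g x\<bar> + \<epsilon>/2" if "x \<in> {0..1}" for x
      using p(2)[OF that] by linarith
  qed
  also have "\<dots> = integral {0..1} (\<lambda>x. \<bar>f x - g x\<bar>) + \<epsilon>/2"
    using Henstock_Kurzweil_Integration.integral_add[OF i1(2) i2] by simp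
  also have "\<dots> < \<epsilon>" using g by simp
  finally show ?thesis using p' pc by blast
qed

lemma abs_cont_cis:
  "abs_cont_with_deriv (\<lambda>x. cis (s * x)) (\<lambda>x. \<i> * of_real s * cis (s * x))"
proof (rule abs_cont_C1)
  fix x :: real
  have "((\<lambda>x. exp (\<i> * of_real s * of_real x)) has_vector_derivative \<i> * of_real s * exp (\<i> * of_real s * of_real x)) (at x within {0..1})"
    by (rule has_vector_derivative_real_field) (auto intro!: derivative_eq_intros)
  then show "((\<lambda>x. cis (s * x)) has_vector_derivative \<i> * of_real s * cis (s * x)) (at x within {0..1})"
    by (simp add: cis_conv_exp mult.assoc)
qed (intro continuous_intros)

lemma cis_integral_zero:
  assumes "\<sigma> \<noteq> 0" "cis \<sigma> = 1"
  shows "((\<lambda>x. cis (\<sigma> * x)) has_integral 0) {0..1}"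
proof -
  have "((\<lambda>x. \<i> * of_real \<sigma> * cis (\<sigma> * x)) has_integral 0) {0..1}"
    using abs_cont_integral[OF abs_cont_cis[of \<sigma>], of 0 1] assms by simp
  then have "((\<lambda>x. 1 / (\<i> * of_real \<sigma>) * (\<i> * of_real \<sigma> * cis (\<sigma> * x))) has_integral
      1 / (\<i> * of_real \<sigma>) * 0) {0..1}"
    by (rule has_integral_mult_right)
  then show ?thesis using assms by simp
qed

lemma absolutely_integrable_of_real:
  fixes f :: "real \<Rightarrow> real"
  assumes "f absolutely_integrable_on S"
  shows "(\<lambda>x. complex_of_real (f x)) absolutely_integrable_on S"
  using absolutely_integrable_linear[OF assms bounded_linear_of_real] by (simp add: o_def)

text \<open>After an \<open>L\<^sub>1\<close> approximation of \<open>f\<close> by a \<open>C\<^sup>1\<close> function one integration by parts gives a bound of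
order \<open>1 / s\<close>. The approximation error does not see the upper limit \<open>x\<close> of the integral, so the
estimate is uniform in \<open>x\<close>; it is this uniformity that makes the double integrals in the second
order terms of the secular equation small.\<close>

lemma riemann_lebesgue_uniform:
  fixes f :: "real \<Rightarrow> real"
  assumes f: "f absolutely_integrable_on {0..1}" and \<epsilon>: "\<epsilon> > 0"
  shows "\<exists>S>0. \<forall>s x. S \<le> \<bar>s\<bar> \<longrightarrow> x \<in> {0..1} \<longrightarrow>
           cmod (integral {0..x} (\<lambda>t. of_real (f t) * cis (s * t))) \<le> \<epsilon>"
proof -
  obtain p p' where p: "\<And>x. (p has_real_derivative p' x) (at x)" and p'c: "continuous_on {0..1} p'"
    and fp: "integral {0..1} (\<lambda>x. \<bar>f x - p x\<bar>) < \<epsilon>/2"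
    using L1_approx_C1[OF f, of "\<epsilon>/2"] \<epsilon> by auto
  have pc: "continuous_on {0..1} p"
    using p by (meson DERIV_continuous_on has_field_derivative_at_within)
  obtain M1 where M1: "\<And>x. x \<in> {0..1} \<Longrightarrow> \<bar>p x\<bar> \<le> M1"
    using compact_imp_bounded[OF compact_continuous_image[OF pc compact_Icc]]
    unfolding bounded_iff real_norm_def by blast
  obtain M2 where M2: "\<And>x. x \<in> {0..1} \<Longrightarrow> \<bar>p' x\<bar> \<le> M2"
    using compact_imp_bounded[OF compact_continuous_image[OF p'c compact_Icc]]
    unfolding bounded_iff real_norm_def by blast
  define M where "M = max M1 M2"
  have M: "\<bar>p x\<bar> \<le> M" "\<bar>p' x\<bar> \<le> M" if "x \<in> {0..1}" for x
    using M1[OF that] M2[OF that] by (auto simp: M_def)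
  have M0: "M \<ge> 0" using M(1)[of 0] by auto
  define S where "S = 6 * M / \<epsilon> + 1"
  have S: "S > 0" using M0 \<epsilon> by (simp add: S_def add_nonneg_pos)
  have acp: "abs_cont_with_deriv (\<lambda>x. of_real (p x)) (\<lambda>x. complex_of_real (p' x))"
    by (rule abs_cont_C1)
      (intro continuous_intros p'c has_vector_derivative_of_real has_field_derivative_at_within[OF p])+
  show ?thesis
  proof (intro exI[of _ S] conjI allI impI S)
    fix s x :: real assume s: "S \<le> \<bar>s\<bar>" and x: "x \<in> {0..1}"
    have s0: "s \<noteq> 0" "\<bar>s\<bar> > 0" using s S by auto
    define E where "E = (\<lambda>t. 1 / (\<i> * of_real s) * cis (s * t))"
    have acE: "abs_cont_with_deriv E (\<lambda>t. cis (s * t))"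
      by (rule abs_cont_cong[OF abs_cont_cmult[OF abs_cont_cis[of s], of "1 / (\<i> * of_real s)"]])
        (use s0 in \<open>auto simp: E_def\<close>)
    have nE: "cmod (E t) = 1 / \<bar>s\<bar>" for t
      by (simp add: E_def norm_mult norm_divide)
    have I: "((\<lambda>t. of_real (p' t) * E t + of_real (p t) * cis (s * t)) has_integral
               of_real (p x) * E x - of_real (p 0) * E 0) {0..x}"
      using abs_cont_integral[OF abs_cont_mult[OF acp acE], of 0 x] x by simp
    have sub: "{0..x} \<subseteq> {0..1}" using x by auto
    have i1: "(\<lambda>t. of_real (p' t) * E t) integrable_on {0..x}"
      by (intro integrable_continuous_real continuous_intros continuous_on_subset[OF p'c sub]
          continuous_on_subset[OF abs_cont_continuous[OF acE] sub])
    have i2: "(\<lambda>t. of_real (p t) * cis (s * t)) integrable_on {0..x}"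
      by (intro integrable_continuous_real continuous_intros continuous_on_subset[OF pc sub])
    have i3: "(\<lambda>t. of_real (f t - p t) * cis (s * t)) integrable_on {0..x}"
    proof -
      have "(\<lambda>t. complex_of_real (f t - p t)) absolutely_integrable_on {0..1}"
        by (intro absolutely_integrable_of_real set_integral_diff f absolutely_integrable_continuous_real pc)
      then have "(\<lambda>t. of_real (f t - p t) * cis (s * t)) absolutely_integrable_on {0..1}"
        by (rule absolutely_integrable_mult_continuous) (intro continuous_intros)
      then show ?thesis
        using sub by (auto simp: absolutely_integrable_on_def intro: integrable_on_subinterval)
    qed
    have eq: "integral {0..x} (\<lambda>t. of_real (p t) * cis (s * t)) =
        of_real (p x) * E x - of_real (p 0) * E 0 - integral {0..x} (\<lambda>t. of_real (p' t) * E t)"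
      using integral_unique[OF I] Henstock_Kurzweil_Integration.integral_add[OF i1 i2] by (simp add: algebra_simps)
    have "cmod (integral {0..x} (\<lambda>t. of_real (p' t) * E t)) \<le> M / \<bar>s\<bar> * (x - 0)"
    proof (rule integral_bound)
      show "continuous_on {0..x} (\<lambda>t. of_real (p' t) * E t)"
        by (intro continuous_intros continuous_on_subset[OF p'c sub]
          continuous_on_subset[OF abs_cont_continuous[OF acE] sub])
      show "cmod (of_real (p' t) * E t) \<le> M / \<bar>s\<bar>" if "t \<in> {0..x}" for t
        using M(2)[of t] that x by (auto simp: norm_mult nE divide_right_mono)
    qed (use x in auto)
    also have "\<dots> \<le> M / \<bar>s\<bar>"
      using x M0 mult_left_le[of "x - 0" "M / \<bar>s\<bar>"] by simp
    finally have b1: "cmod (integral {0..x} (\<lambda>t. of_real (p' t) * E t)) \<le> M / \<bar>s\<bar>" .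
    have b2: "cmod (of_real (p x) * E x) \<le> M / \<bar>s\<bar>" "cmod (of_real (p 0) * E 0) \<le> M / \<bar>s\<bar>"
      using M(1)[of x] M(1)[of 0] x by (auto simp: norm_mult nE divide_right_mono)
    have "cmod (integral {0..x} (\<lambda>t. of_real (p t) * cis (s * t))) \<le> M / \<bar>s\<bar> + M / \<bar>s\<bar> + M / \<bar>s\<bar>"
      unfolding eq
      by (rule norm_triangle_le_diff[OF add_mono[OF norm_triangle_le_diff[OF add_mono[OF b2]] b1]])
    also have "\<dots> = 3 * M / \<bar>s\<bar>" by simp
    also have "\<dots> \<le> \<epsilon> / 2"
    proof -
      have "6 * M \<le> \<epsilon> * S" using \<epsilon> by (simp add: S_def field_simps)
      also have "\<dots> \<le> \<epsilon> * \<bar>s\<bar>" using s \<epsilon> by simp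
      finally show ?thesis using s0 by (simp add: field_simps)
    qed
    finally have b3: "cmod (integral {0..x} (\<lambda>t. of_real (p t) * cis (s * t))) \<le> \<epsilon> / 2" .
    have fpi: "(\<lambda>t. \<bar>f t - p t\<bar>) integrable_on {0..1}"
      using set_integral_diff(1)[OF f absolutely_integrable_continuous_real[OF pc]]
      by (simp add: absolutely_integrable_on_def)
    have "cmod (integral {0..x} (\<lambda>t. of_real (f t - p t) * cis (s * t))) \<le> integral {0..x} (\<lambda>t. \<bar>f t - p t\<bar>)"
      by (rule integral_norm_bound_integral[OF i3 integrable_on_subinterval[OF fpi sub]])
        (simp add: norm_mult flip: of_real_diff)
    also have "\<dots> \<le> integral {0..1} (\<lambda>t. \<bar>f t - p t\<bar>)"
      by (rule integral_subset_le[OF sub integrable_on_subinterval[OF fpi sub] fpi]) auto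
    finally have b4: "cmod (integral {0..x} (\<lambda>t. of_real (f t - p t) * cis (s * t))) \<le> \<epsilon> / 2"
      using fp by simp
    have "integral {0..x} (\<lambda>t. of_real (f t) * cis (s * t)) =
       integral {0..x} (\<lambda>t. of_real (f t - p t) * cis (s * t)) + integral {0..x} (\<lambda>t. of_real (p t) * cis (s * t))"
      using Henstock_Kurzweil_Integration.integral_add[OF i3 i2] by (simp add: algebra_simps)
    then show "cmod (integral {0..x} (\<lambda>t. of_real (f t) * cis (s * t))) \<le> \<epsilon>"
      using norm_triangle_mono[OF b4 b3] by simp
  qed
qed

section \<open>Variation of constants and the secular equation\<close>

text \<open>A solution of \<open>- y'' + q y = lam y\<close> together with its derivative \<open>u\<close>, as a first order system. Carrying
\<open>u\<close> along makes linear combinations of solutions and their initial data explicit.\<close>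

definition antiperiodic_solution :: "(real \<Rightarrow> real) \<Rightarrow> real \<Rightarrow> (real \<Rightarrow> complex) \<Rightarrow> (real \<Rightarrow> complex) \<Rightarrow> bool" where
  "antiperiodic_solution q lam y u \<longleftrightarrow>
     abs_cont_with_deriv y u \<and> abs_cont_with_deriv u (\<lambda>x. of_real (q x - lam) * y x) \<and>
     y 1 = - y 0 \<and> u 1 = - u 0"

text \<open>Variation of constants against \<open>y'' + s\<^sup>2 y = 0\<close>: the coefficients of \<open>cis (s * x)\<close> and
\<open>cis (- s * x)\<close> in \<open>y\<close> are the amplitudes for \<open>s\<close> and \<open>- s\<close>.\<close>

definition amplitude :: "real \<Rightarrow> (real \<Rightarrow> complex) \<Rightarrow> (real \<Rightarrow> complex) \<Rightarrow> real \<Rightarrow> complex" where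
  "amplitude s y u x = (y x + u x / (\<i> * of_real s)) / 2 * cis (- s * x)"

lemma amplitude_decomposition:
  assumes "s \<noteq> 0"
  shows "y x = amplitude s y u x * cis (s * x) + amplitude (- s) y u x * cis (- s * x)"
proof -
  have inv: "cis (- s * x) * cis (s * x) = 1" "cis (- (- s) * x) * cis (- s * x) = 1"
    by (simp_all add: cis_mult)
  have eqs: "amplitude s y u x * cis (s * x) = (y x + u x / (\<i> * of_real s)) / 2"
    "amplitude (- s) y u x * cis (- s * x) = (y x + u x / (\<i> * of_real (- s))) / 2"
    unfolding amplitude_def mult.assoc inv by simp_all
  show ?thesis unfolding eqs using assms by (simp add: field_simps)
qed

text \<open>A solution for the spectral parameter \<open>s\<^sup>2 + \<delta>\<close>, where \<open>s\<close> is an odd multiple of \<open>\<pi>\<close>. The sign of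
\<open>s\<close> is left open: replacing \<open>s\<close> by \<open>- s\<close> interchanges the two amplitudes (lemma \<open>reflect\<close>), and
thus yields the second secular equation from the first.\<close>

locale oscillation =
  fixes q :: "real \<Rightarrow> real" and \<delta> s :: real and y u :: "real \<Rightarrow> complex"
  assumes q: "q absolutely_integrable_on {0..1}" and mean: "integral {0..1} q = 0"
    and s0: "s \<noteq> 0" and cis_s: "cis s = - 1"
    and sol: "antiperiodic_solution q (s\<^sup>2 + \<delta>) y u"
begin

definition p :: "real \<Rightarrow> real" where "p x = q x - \<delta>"
definition N :: real where "N = integral {0..1} (\<lambda>x. \<bar>p x\<bar>)"
definition pint :: "(real \<Rightarrow> complex) \<Rightarrow> real \<Rightarrow> complex" where
  "pint w x = integral {0..x} (\<lambda>t. of_real (p t) * w t)"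
definition a :: "real \<Rightarrow> complex" where "a = amplitude s y u"
definition b :: "real \<Rightarrow> complex" where "b = amplitude (- s) y u"
definition V :: real where "V = cmod (a 0) + cmod (b 0)"

lemma cis_neg_s: "cis (- s) = - 1"
  using cis_inverse[of s] cis_s by simp

lemma reflect: "oscillation q \<delta> (- s) y u"
  using q mean s0 cis_neg_s sol by unfold_locales auto

lemma p_int: "p absolutely_integrable_on {0..1}"
  unfolding p_def by (intro set_integral_diff(1) q absolutely_integrable_continuous_real continuous_intros)

lemma pw_int:
  fixes w :: "real \<Rightarrow> complex"
  shows "continuous_on {0..1} w \<Longrightarrow> (\<lambda>t. of_real (p t) * w t) absolutely_integrable_on {0..1}"
  by (rule absolutely_integrable_mult_continuous[OF absolutely_integrable_of_real[OF p_int]])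

lemma pint_abs_cont: "continuous_on {0..1} w \<Longrightarrow> abs_cont_with_deriv (pint w) (\<lambda>t. of_real (p t) * w t)"
  unfolding pint_def by (rule abs_cont_indefinite_integral[OF pw_int])

lemma pint_0 [simp]: "pint w 0 = 0"
  by (simp add: pint_def)

lemma pint_continuous: "continuous_on {0..1} w \<Longrightarrow> continuous_on {0..1} (pint w)"
  using abs_cont_continuous pint_abs_cont by blast

lemma pw_integrable:
  fixes w :: "real \<Rightarrow> complex"
  assumes "continuous_on {0..1} w" "x \<in> {0..1}"
  shows "(\<lambda>t. of_real (p t) * w t) integrable_on {0..x}"
  using pw_int[OF assms(1)] assms(2)
  unfolding absolutely_integrable_on_def by (auto intro: integrable_on_subinterval)

lemma pint_add:
  assumes "continuous_on {0..1} w" "continuous_on {0..1} v" "x \<in> {0..1}"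
  shows "pint (\<lambda>t. w t + v t) x = pint w x + pint v x"
  unfolding pint_def distrib_left
  by (rule Henstock_Kurzweil_Integration.integral_add) (intro pw_integrable assms)+

lemma pint_cmult: "pint (\<lambda>t. c * w t) x = c * pint w x"
  unfolding pint_def by (subst integral_mult_right[symmetric]) (simp add: algebra_simps)

lemma pint_cong: "x \<in> {0..1} \<Longrightarrow> (\<And>t. t \<in> {0..1} \<Longrightarrow> w t = v t) \<Longrightarrow> pint w x = pint v x"
  unfolding pint_def by (rule integral_cong) auto

lemma p_abs_integrable: "(\<lambda>x. \<bar>p x\<bar>) integrable_on {0..1}"
  using p_int by (simp add: absolutely_integrable_on_def)

lemma N_nonneg: "N \<ge> 0"
  unfolding N_def by (rule integral_nonneg[OF p_abs_integrable]) auto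

lemma pint_bound:
  assumes w: "continuous_on {0..1} w" and B: "\<And>t. t \<in> {0..1} \<Longrightarrow> cmod (w t) \<le> B" and x: "x \<in> {0..1}"
  shows "cmod (pint w x) \<le> N * B"
proof -
  have sub: "{0..x} \<subseteq> {0..1}" using x by auto
  have B0: "B \<ge> 0" using order_trans[OF norm_ge_zero B[of 0]] by simp
  have "cmod (pint w x) \<le> B * integral {0..x} (\<lambda>t. cmod (of_real (p t)))"
    unfolding pint_def
    by (rule integral_norm_mult_le[OF absolutely_integrable_of_real[OF p_int] w]) (use B x in auto)
  also have "\<dots> \<le> B * N"
    unfolding N_def norm_of_real
    by (intro mult_left_mono integral_subset_le[OF sub integrable_on_subinterval[OF p_abs_integrable sub] p_abs_integrable])
      (use B0 in auto)
  finally show ?thesis by (simp add: mult.commute)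
qed

lemma y_abs_cont: "abs_cont_with_deriv y u"
  and u_abs_cont: "abs_cont_with_deriv u (\<lambda>x. of_real (q x - (s\<^sup>2 + \<delta>)) * y x)"
  using sol by (auto simp: antiperiodic_solution_def)

lemma y_continuous: "continuous_on {0..1} y"
  by (rule abs_cont_continuous[OF y_abs_cont])

text \<open>With \<open>y'' + s\<^sup>2 y = p y\<close> and \<open>p = q - \<delta>\<close>, the contributions of \<open>u\<close> to the derivative of the amplitude
cancel. What is left carries the factor \<open>1 / s\<close>, so the amplitude is nearly constant.\<close>

lemma a_abs_cont:
  "abs_cont_with_deriv a (\<lambda>x. 1 / (2 * \<i> * of_real s) * (of_real (p x) * (y x * cis (- s * x))))"
proof -
  have *: "abs_cont_with_deriv (\<lambda>x. 1 / 2 * (y x + 1 / (\<i> * of_real s) * u x) * cis (- s * x))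
    (\<lambda>x. 1 / 2 * (u x + 1 / (\<i> * of_real s) * (of_real (q x - (s\<^sup>2 + \<delta>)) * y x)) * cis (- s * x)
      + 1 / 2 * (y x + 1 / (\<i> * of_real s) * u x) * (\<i> * of_real (- s) * cis (- s * x)))"
    by (intro abs_cont_mult abs_cont_cmult abs_cont_add y_abs_cont u_abs_cont abs_cont_cis)
  show ?thesis
  proof (rule abs_cont_cong[OF *])
    fix x :: real
    show "1 / 2 * (y x + 1 / (\<i> * of_real s) * u x) * cis (- s * x) = a x"
      by (simp add: a_def amplitude_def)
    define C k Q where "C = cis (- s * x)" and "k = 1 / (\<i> * complex_of_real s)"
      and "Q = complex_of_real (q x - (s\<^sup>2 + \<delta>))"
    have k1: "k * (\<i> * of_real s) = 1" using s0 by (simp add: k_def)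
    have k2: "\<i> * of_real s = - (k * of_real (s\<^sup>2))"
      using s0 by (simp add: k_def power2_eq_square field_simps)
    have pQ: "of_real (p x) = Q + of_real (s\<^sup>2)" by (simp add: p_def Q_def)
    have "1 / 2 * (u x + k * (Q * y x)) * C + 1 / 2 * (y x + k * u x) * (\<i> * of_real (- s) * C)
      = 1 / 2 * C * (u x + k * Q * y x - (\<i> * of_real s) * y x - (k * (\<i> * of_real s)) * u x)"
      by (simp add: algebra_simps)
    also have "\<dots> = 1 / 2 * C * (k * Q * y x - (\<i> * of_real s) * y x)"
      unfolding k1 by simp
    also have "\<dots> = k / 2 * (of_real (p x) * (y x * C))"
      unfolding k2 pQ by (simp add: algebra_simps)
    also have "k / 2 = 1 / (2 * \<i> * of_real s)"
      by (simp add: k_def)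
    finally show "1 / 2 * (u x + 1 / (\<i> * of_real s) * (of_real (q x - (s\<^sup>2 + \<delta>)) * y x)) * cis (- s * x)
      + 1 / 2 * (y x + 1 / (\<i> * of_real s) * u x) * (\<i> * of_real (- s) * cis (- s * x))
      = 1 / (2 * \<i> * of_real s) * (of_real (p x) * (y x * cis (- s * x)))"
      unfolding C_def k_def Q_def .
  qed
qed

lemma a_continuous: "continuous_on {0..1} a"
  by (rule abs_cont_continuous[OF a_abs_cont])

lemma b_continuous: "continuous_on {0..1} b"
  using oscillation.a_continuous[OF reflect] by (simp add: b_def oscillation.a_def[OF reflect])

lemma ycis_continuous: "continuous_on {0..1} (\<lambda>x. y x * cis (- s * x))"
  by (intro continuous_intros y_continuous)

lemma a_eq:
  assumes "x \<in> {0..1}"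
  shows "a x - a 0 = 1 / (2 * \<i> * of_real s) * pint (\<lambda>x. y x * cis (- s * x)) x"
  using integral_unique[OF abs_cont_integral[OF a_abs_cont, of 0 x]] assms
  unfolding pint_def by simp

lemma a_1: "a 1 = a 0"
  using sol cis_neg_s by (simp add: a_def amplitude_def antiperiodic_solution_def field_simps)

text \<open>Both \<open>y\<close> and \<open>cis (- s * x)\<close> change sign over the interval, so the amplitude is periodic and its
derivative has mean zero. This is the exact form of the secular equation.\<close>

lemma pint_ycis_1: "pint (\<lambda>x. y x * cis (- s * x)) 1 = 0"
  using a_eq[of 1] a_1 s0 by simp

lemma ycis_split: "y x * cis (- s * x) = a x + b x * cis (- (2 * s) * x)"
proof -
  have eqs: "cis (s * x) * cis (- s * x) = 1" "cis (- s * x) * cis (- s * x) = cis (- (2 * s) * x)"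
    by (simp_all add: cis_mult algebra_simps)
  have "y x * cis (- s * x) = amplitude s y u x * (cis (s * x) * cis (- s * x))
      + amplitude (- s) y u x * (cis (- s * x) * cis (- s * x))"
    by (subst amplitude_decomposition[OF s0, of y x u]) (simp only: distrib_right mult.assoc)
  then show ?thesis unfolding eqs a_def b_def by simp
qed

lemma y_le: "cmod (y x) \<le> cmod (a x) + cmod (b x)"
  using norm_triangle_ineq[of "a x" "b x * cis (- (2 * s) * x)"] ycis_split[of x]
  by (metis norm_mult norm_cis mult.right_neutral)

lemma a_drift:
  assumes "\<And>t. t \<in> {0..1} \<Longrightarrow> cmod (y t) \<le> K" "x \<in> {0..1}"
  shows "cmod (a x - a 0) \<le> N * K / (2 * \<bar>s\<bar>)"
proof -
  have "cmod (pint (\<lambda>x. y x * cis (- s * x)) x) \<le> N * K"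
    by (rule pint_bound[OF ycis_continuous _ assms(2)]) (use assms(1) in \<open>simp add: norm_mult\<close>)
  then show ?thesis
    unfolding a_eq[OF assms(2)] by (simp add: norm_mult norm_divide divide_right_mono)
qed

lemma b_drift:
  assumes "\<And>t. t \<in> {0..1} \<Longrightarrow> cmod (y t) \<le> K" "x \<in> {0..1}"
  shows "cmod (b x - b 0) \<le> N * K / (2 * \<bar>s\<bar>)"
  using oscillation.a_drift[OF reflect assms]
  by (simp add: b_def oscillation.a_def[OF reflect] N_def oscillation.N_def[OF reflect] p_def oscillation.p_def[OF reflect])

lemma V_nonneg: "V \<ge> 0" by (simp add: V_def)

text \<open>Evaluating the drift bound at a point where \<open>cmod (a x) + cmod (b x)\<close> attains its maximum \<open>K\<close> gives
\<open>K \<le> V + K / 2\<close>, hence \<open>K \<le> 2 * V\<close>.\<close>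

lemma y_bound:
  assumes small: "N \<le> \<bar>s\<bar> / 2" and x: "x \<in> {0..1}"
  shows "cmod (y x) \<le> 2 * V"
proof -
  have "continuous_on {0..1} (\<lambda>x. cmod (a x) + cmod (b x))"
    by (intro continuous_intros a_continuous b_continuous)
  then obtain m where m: "m \<in> {0..1}" "\<And>t. t \<in> {0..1} \<Longrightarrow> cmod (a t) + cmod (b t) \<le> cmod (a m) + cmod (b m)"
    using continuous_attains_sup[of "{0..1::real}" "\<lambda>x. cmod (a x) + cmod (b x)"] by auto
  define K where "K = cmod (a m) + cmod (b m)"
  have yK: "cmod (y t) \<le> K" if "t \<in> {0..1}" for t
    using y_le[of t] m(2)[OF that] by (simp add: K_def)
  have K0: "K \<ge> 0" by (simp add: K_def)
  have "cmod (a m) \<le> cmod (a 0) + N * K / (2 * \<bar>s\<bar>)" "cmod (b m) \<le> cmod (b 0) + N * K / (2 * \<bar>s\<bar>)"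
    using a_drift[OF yK m(1)] b_drift[OF yK m(1)]
      norm_triangle_ineq2[of "a m" "a 0"] norm_triangle_ineq2[of "b m" "b 0"] by simp_all
  moreover have "N * K / (2 * \<bar>s\<bar>) \<le> K / 4"
    using mult_right_mono[OF small K0] s0 by (simp add: field_simps)
  ultimately have "K \<le> V + K / 2"
    unfolding V_def using K_def by linarith
  then show ?thesis using yK[OF x] by simp
qed

lemma drift:
  assumes small: "N \<le> \<bar>s\<bar> / 2" and x: "x \<in> {0..1}"
  shows "cmod (a x - a 0) \<le> N * V / \<bar>s\<bar>" "cmod (b x - b 0) \<le> N * V / \<bar>s\<bar>"
  using a_drift[OF y_bound[OF small] x] b_drift[OF y_bound[OF small] x] by simp_all

text \<open>The part of \<open>y x * cis (- s * x)\<close> that is due to the drift of the amplitudes away from their initial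
values.\<close>

definition D :: "real \<Rightarrow> complex" where
  "D x = (a x - a 0) + (b x - b 0) * cis (- (2 * s) * x)"

lemma D_continuous: "continuous_on {0..1} D"
  unfolding D_def by (intro continuous_intros a_continuous b_continuous)

lemma D_bound:
  assumes small: "N \<le> \<bar>s\<bar> / 2" and x: "x \<in> {0..1}"
  shows "cmod (D x) \<le> 2 * N * V / \<bar>s\<bar>"
proof -
  have "cmod ((b x - b 0) * cis (- (2 * s) * x)) \<le> N * V / \<bar>s\<bar>"
    using drift(2)[OF small x] by (simp add: norm_mult)
  from norm_triangle_mono[OF drift(1)[OF small x] this] show ?thesis
    by (simp add: D_def)
qed

lemma pint_ycis:
  assumes "x \<in> {0..1}"
  shows "pint (\<lambda>x. y x * cis (- s * x)) x =
     a 0 * pint (\<lambda>_. 1) x + b 0 * pint (\<lambda>t. cis (- (2 * s) * t)) x + pint D x"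
proof -
  define e where "e = (\<lambda>t. cis (- (2 * s) * t))"
  have ec: "continuous_on {0..1} e" unfolding e_def by (intro continuous_intros)
  have "(\<lambda>t. y t * cis (- s * t)) = (\<lambda>t. (a 0 * 1 + b 0 * e t) + D t)"
    unfolding ycis_split D_def e_def by (rule ext) (simp add: algebra_simps)
  moreover have "pint (\<lambda>t. (a 0 * 1 + b 0 * e t) + D t) x
      = pint (\<lambda>t. a 0 * 1 + b 0 * e t) x + pint D x"
    by (rule pint_add[OF _ D_continuous assms]) (intro continuous_intros ec)
  moreover have "pint (\<lambda>t. a 0 * 1 + b 0 * e t) x = pint (\<lambda>t. a 0 * 1) x + pint (\<lambda>t. b 0 * e t) x"
    by (rule pint_add[OF _ _ assms]) (intro continuous_intros ec)+
  ultimately show ?thesis unfolding pint_cmult e_def by simp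
qed

lemma p_integral: "integral {0..1} p = - \<delta>"
proof -
  have "q integrable_on {0..1}" using q by (simp add: absolutely_integrable_on_def)
  then show ?thesis
    unfolding p_def using mean by (subst Henstock_Kurzweil_Integration.integral_diff) auto
qed

lemma pint_1: "pint (\<lambda>_. 1) 1 = - of_real \<delta>"
proof -
  have "p integrable_on {0..1}" using p_int by (simp add: absolutely_integrable_on_def)
  from integral_linear[OF this bounded_linear_of_real[where 'a=complex]] show ?thesis
    by (simp add: pint_def p_integral o_def)
qed

definition c :: complex where
  "c = integral {0..1} (\<lambda>x. of_real (q x) * cis (- (2 * s) * x))"

lemma integral_cis_2s: "integral {0..1} (\<lambda>x. cis (- (2 * s) * x)) = 0"
proof (rule integral_unique[OF cis_integral_zero])
  show "cis (- (2 * s)) = 1" using cis_neg_s cis_mult[of "- s" "- s"] by simp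
qed (use s0 in simp)

lemma qcis_integrable: "x \<in> {0..1} \<Longrightarrow> (\<lambda>t. of_real (q t) * cis (r * t)) integrable_on {0..x}"
  using absolutely_integrable_mult_continuous[OF absolutely_integrable_of_real[OF q]
      continuous_on_cis[OF continuous_on_mult_left[OF continuous_on_id]], of r]
  unfolding absolutely_integrable_on_def by (auto intro: integrable_on_subinterval)

lemma pint_cis:
  assumes "x \<in> {0..1}"
  shows "pint (\<lambda>t. cis (r * t)) x = integral {0..x} (\<lambda>t. of_real (q t) * cis (r * t))
      - of_real \<delta> * integral {0..x} (\<lambda>t. cis (r * t))"
proof -
  have "(\<lambda>t. of_real \<delta> * cis (r * t)) integrable_on {0..x}"
    by (intro integrable_continuous_real continuous_intros)
  from Henstock_Kurzweil_Integration.integral_diff[OF qcis_integrable[OF assms, of r] this]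
  show ?thesis by (simp add: pint_def p_def algebra_simps)
qed

lemma pint_cis_1: "pint (\<lambda>t. cis (- (2 * s) * t)) 1 = c"
  using pint_cis[of 1 "- (2 * s)"] integral_cis_2s by (simp add: c_def)

lemma pint_cis_bound:
  assumes "x \<in> {0..1}"
  shows "cmod (pint (\<lambda>t. cis (r * t)) x) \<le> cmod (integral {0..x} (\<lambda>t. of_real (q t) * cis (r * t))) + \<bar>\<delta>\<bar>"
proof -
  have "cmod (integral {0..x} (\<lambda>t. cis (r * t))) \<le> 1 * (x - 0)"
    by (rule integral_bound) (use assms in \<open>auto intro!: continuous_intros\<close>)
  then have "cmod (of_real \<delta> * integral {0..x} (\<lambda>t. cis (r * t))) \<le> \<bar>\<delta>\<bar>"
    using assms mult_left_mono[of "cmod (integral {0..x} (\<lambda>t. cis (r * t)))" 1 "\<bar>\<delta>\<bar>"] by (simp add: norm_mult)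
  then show ?thesis
    unfolding pint_cis[OF assms] using norm_triangle_ineq4 order_trans by (smt (verit))
qed

text \<open>The first order of the secular equation: the constant parts of the amplitudes contribute
\<open>- \<delta>\<close> (the mean of \<open>p\<close>) and the Fourier coefficient \<open>c\<close>, and everything else sits in the
drift \<open>D\<close>.\<close>

lemma secular_equation: "of_real \<delta> * a 0 - c * b 0 = pint D 1"
proof -
  have one: "1 \<in> {0..1::real}" by simp
  show ?thesis
    using pint_ycis[OF one] unfolding pint_ycis_1 pint_1 pint_cis_1 by (simp add: algebra_simps)
qed

lemma secular_crude:
  assumes small: "N \<le> \<bar>s\<bar> / 2"
  shows "cmod (of_real \<delta> * a 0 - c * b 0) \<le> 2 * N\<^sup>2 * V / \<bar>s\<bar>"
  unfolding secular_equation
  using pint_bound[OF D_continuous D_bound[OF small], of 1] by (simp add: power2_eq_square algebra_simps)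

lemma delta_le_N: "\<bar>\<delta>\<bar> \<le> N"
  using pint_bound[of "\<lambda>_. 1" 1 1] by (simp add: pint_1)

lemma pint_by_parts:
  assumes w: "continuous_on {0..1} w" and v: "continuous_on {0..1} v"
  shows "pint (\<lambda>t. v t * pint w t) 1 + pint (\<lambda>t. w t * pint v t) 1 = pint v 1 * pint w 1"
proof -
  have vw: "continuous_on {0..1} (\<lambda>t. v t * pint w t)" "continuous_on {0..1} (\<lambda>t. w t * pint v t)"
    by (intro continuous_intros w v pint_continuous)+
  have "((\<lambda>t. of_real (p t) * v t * pint w t + pint v t * (of_real (p t) * w t))
           has_integral pint v 1 * pint w 1 - pint v 0 * pint w 0) {0..1}"
    by (rule abs_cont_integral[OF abs_cont_mult[OF pint_abs_cont[OF v] pint_abs_cont[OF w]]]) auto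
  moreover have "(\<lambda>t. of_real (p t) * v t * pint w t + pint v t * (of_real (p t) * w t))
      = (\<lambda>t. of_real (p t) * (v t * pint w t + w t * pint v t))"
    by (rule ext) (simp add: algebra_simps)
  ultimately have "pint (\<lambda>t. v t * pint w t + w t * pint v t) 1 = pint v 1 * pint w 1"
    unfolding pint_def[of "\<lambda>t. v t * pint w t + w t * pint v t"] by (simp add: integral_unique)
  then show ?thesis
    using pint_add[OF vw, of 1] by simp
qed

lemma pint_pint_1: "pint (pint (\<lambda>_. 1)) 1 = of_real (\<delta>\<^sup>2 / 2)"
  using pint_by_parts[of "\<lambda>_. 1" "\<lambda>_. 1"] by (simp add: pint_1 power2_eq_square eq_divide_eq mult.commute)

text \<open>The remainder \<open>pint D 1\<close> is expanded once more: to leading order the drift of \<open>a\<close> and \<open>b\<close> is a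
combination of primitives of \<open>p\<close> and of \<open>p\<close> times \<open>cis (- 2 s x)\<close> or \<open>cis (2 s x)\<close>. Of the four double
integrals that arise, two contain a primitive of an oscillating factor, which is at most \<open>\<rho>\<close>, and a third
does so after integration by parts. The fourth, \<open>\<integral> p P\<close> for the primitive \<open>P\<close> of \<open>p\<close>, is the
integral of an exact differential and equals \<open>\<delta>\<^sup>2 / 2\<close>. The drift of the drift accounts for the term with
\<open>N ^ 3\<close>. So the bracket tends to zero when \<open>\<delta>\<close>, \<open>\<rho>\<close> and \<open>1 / s\<close> do, and the remainder is \<open>o(1 / s)\<close>.\<close>

lemma secular_refined:
  assumes small: "N \<le> \<bar>s\<bar> / 2"
    and \<rho>: "\<And>x. x \<in> {0..1} \<Longrightarrow> cmod (pint (\<lambda>t. cis (- (2 * s) * t)) x) \<le> \<rho>"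
    and \<rho>': "\<And>x. x \<in> {0..1} \<Longrightarrow> cmod (pint (\<lambda>t. cis (2 * s * t)) x) \<le> \<rho>"
  shows "cmod (of_real \<delta> * a 0 - c * b 0) \<le> V / (2 * \<bar>s\<bar>) * (\<delta>\<^sup>2 + 4 * N * \<rho> + 4 * N ^ 3 / \<bar>s\<bar>)"
proof -
  interpret r: oscillation q \<delta> "- s" y u by (rule reflect)
  have ra: "r.a = b" "r.b = a" by (simp_all add: a_def b_def r.a_def r.b_def)
  have rV: "r.V = V" by (simp add: V_def r.V_def ra)
  have one: "1 \<in> {0..1::real}" by simp
  define e where "e = (\<lambda>t. cis (- (2 * s) * t))"
  define e' where "e' = (\<lambda>t. cis (2 * s * t))"
  define P where "P = pint (\<lambda>_. 1)"
  define R where "R = pint e"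
  define R' where "R' = pint e'"
  define G where "G = pint D"
  define G' where "G' = pint r.D"
  define \<kappa> where "\<kappa> = 1 / (2 * \<i> * complex_of_real s)"
  have ec: "continuous_on {0..1} e" "continuous_on {0..1} e'"
    unfolding e_def e'_def by (intro continuous_intros)+
  have cont: "continuous_on {0..1} P" "continuous_on {0..1} R" "continuous_on {0..1} R'"
    "continuous_on {0..1} G" "continuous_on {0..1} G'"
    unfolding P_def R_def R'_def G_def G'_def
    by (intro pint_continuous ec D_continuous r.D_continuous continuous_intros)+
  have ne: "cmod (e t) = 1" for t by (simp add: e_def)
  have \<rho>0: "\<rho> \<ge> 0" using order_trans[OF norm_ge_zero \<rho>[OF one]] .
  have Rb: "cmod (R t) \<le> \<rho>" "cmod (R' t) \<le> \<rho>" if "t \<in> {0..1}" for t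
    using \<rho>[OF that] \<rho>'[OF that] by (simp_all add: R_def R'_def e_def e'_def)
  have Gb: "cmod (G t) \<le> N * (2 * N * V / \<bar>s\<bar>)" if "t \<in> {0..1}" for t
    unfolding G_def by (rule pint_bound[OF D_continuous D_bound[OF small] that])
  have G'b: "cmod (G' t) \<le> N * (2 * N * V / \<bar>s\<bar>)" if "t \<in> {0..1}" for t
    unfolding G'_def using pint_bound[OF r.D_continuous r.D_bound that] small by (simp add: rV)
  have a_exp: "a t - a 0 = \<kappa> * (a 0 * P t + b 0 * R t + G t)" if "t \<in> {0..1}" for t
    unfolding a_eq[OF that] pint_ycis[OF that] \<kappa>_def P_def R_def G_def e_def ..
  have b_exp: "b t - b 0 = - \<kappa> * (b 0 * P t + a 0 * R' t + G' t)" if "t \<in> {0..1}" for t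
    using r.a_eq[OF that] r.pint_ycis[OF that] unfolding ra \<kappa>_def P_def R'_def G'_def e'_def by simp
  have D_exp: "D t = \<kappa> * (a 0 * P t + b 0 * R t + G t) - \<kappa> * (b 0 * (e t * P t) + a 0 * (e t * R' t) + e t * G' t)"
    if "t \<in> {0..1}" for t
    unfolding D_def a_exp[OF that] b_exp[OF that] e_def by (simp add: algebra_simps)
  have sum3: "pint (\<lambda>t. k * (x1 * w1 t + x2 * w2 t + w3 t)) 1 = k * (x1 * pint w1 1 + x2 * pint w2 1 + pint w3 1)"
    if "continuous_on {0..1} w1" "continuous_on {0..1} w2" "continuous_on {0..1} w3" for k x1 x2 w1 w2 w3
  proof -
    have "pint (\<lambda>t. (x1 * w1 t + x2 * w2 t) + w3 t) 1 = pint (\<lambda>t. x1 * w1 t + x2 * w2 t) 1 + pint w3 1"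
      by (rule pint_add[OF _ that(3) one]) (intro continuous_intros that)
    moreover have "pint (\<lambda>t. x1 * w1 t + x2 * w2 t) 1 = pint (\<lambda>t. x1 * w1 t) 1 + pint (\<lambda>t. x2 * w2 t) 1"
      by (rule pint_add[OF _ _ one]) (intro continuous_intros that)+
    ultimately show ?thesis unfolding pint_cmult by simp
  qed
  have eP: "continuous_on {0..1} (\<lambda>t. e t * P t)" "continuous_on {0..1} (\<lambda>t. e t * R' t)"
    "continuous_on {0..1} (\<lambda>t. e t * G' t)"
    by (intro continuous_intros ec cont)+
  have "pint D 1 = pint (\<lambda>t. \<kappa> * (a 0 * P t + b 0 * R t + G t)
      + (- \<kappa>) * (b 0 * (e t * P t) + a 0 * (e t * R' t) + e t * G' t)) 1"
    by (rule pint_cong[OF one]) (simp add: D_exp)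
  also have "\<dots> = pint (\<lambda>t. \<kappa> * (a 0 * P t + b 0 * R t + G t)) 1
      + pint (\<lambda>t. (- \<kappa>) * (b 0 * (e t * P t) + a 0 * (e t * R' t) + e t * G' t)) 1"
    by (rule pint_add[OF _ _ one]) (intro continuous_intros cont ec)+
  also have "\<dots> = \<kappa> * (a 0 * pint P 1 + b 0 * pint R 1 + pint G 1)
      + (- \<kappa>) * (b 0 * pint (\<lambda>t. e t * P t) 1 + a 0 * pint (\<lambda>t. e t * R' t) 1 + pint (\<lambda>t. e t * G' t) 1)"
    unfolding sum3[OF cont(1,2,4)] sum3[OF eP] ..
  also have "\<dots> = \<kappa> * ((a 0 * pint P 1 + b 0 * pint R 1 + pint G 1)
      - (b 0 * pint (\<lambda>t. e t * P t) 1 + a 0 * pint (\<lambda>t. e t * R' t) 1 + pint (\<lambda>t. e t * G' t) 1))"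
    by (simp add: algebra_simps)
  finally have D1: "pint D 1 = \<dots>" .
  have n1: "cmod (a 0 * pint P 1) \<le> V * (\<delta>\<^sup>2 / 2)"
    unfolding P_def pint_pint_1 norm_mult norm_of_real by (intro mult_mono) (auto simp: V_def)
  have NR: "cmod (pint R 1) \<le> N * \<rho>"
    by (rule pint_bound[OF cont(2) Rb(1) one])
  have n2: "cmod (b 0 * pint R 1) \<le> cmod (b 0) * (N * \<rho>)"
    unfolding norm_mult by (intro mult_left_mono NR) auto
  have n3: "cmod (pint G 1) \<le> N * (N * (2 * N * V / \<bar>s\<bar>))"
    by (rule pint_bound[OF cont(4) Gb one])
  \<comment> \<open>Here \<open>P\<close> does not oscillate; integration by parts moves the oscillation into the primitive.\<close>
  have "pint (\<lambda>t. e t * P t) 1 = R 1 * P 1 - pint R 1"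
    using pint_by_parts[of "\<lambda>_. 1" e] ec(1) by (simp add: P_def R_def algebra_simps)
  moreover have "cmod (R 1 * P 1) \<le> \<rho> * N"
    unfolding norm_mult using delta_le_N Rb(1)[OF one] \<rho>0 by (intro mult_mono) (auto simp: P_def pint_1)
  ultimately have "cmod (pint (\<lambda>t. e t * P t) 1) \<le> \<rho> * N + N * \<rho>"
    using norm_triangle_le_diff[OF add_mono[OF _ NR], of "R 1 * P 1" "\<rho> * N"] by simp
  then have n4: "cmod (b 0 * pint (\<lambda>t. e t * P t) 1) \<le> cmod (b 0) * (\<rho> * N + N * \<rho>)"
    unfolding norm_mult by (intro mult_left_mono) auto
  have "cmod (pint (\<lambda>t. e t * R' t) 1) \<le> N * \<rho>"
    by (rule pint_bound[OF eP(2) _ one]) (use Rb(2) in \<open>simp add: norm_mult ne\<close>)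
  then have n5: "cmod (a 0 * pint (\<lambda>t. e t * R' t) 1) \<le> cmod (a 0) * (N * \<rho>)"
    unfolding norm_mult by (intro mult_left_mono) auto
  have n6: "cmod (pint (\<lambda>t. e t * G' t) 1) \<le> N * (N * (2 * N * V / \<bar>s\<bar>))"
    by (rule pint_bound[OF eP(3) _ one]) (use G'b in \<open>simp add: norm_mult ne\<close>)
  have "cmod ((a 0 * pint P 1 + b 0 * pint R 1 + pint G 1)
      - (b 0 * pint (\<lambda>t. e t * P t) 1 + a 0 * pint (\<lambda>t. e t * R' t) 1 + pint (\<lambda>t. e t * G' t) 1))
    \<le> (V * (\<delta>\<^sup>2 / 2) + cmod (b 0) * (N * \<rho>) + N * (N * (2 * N * V / \<bar>s\<bar>)))
      + (cmod (b 0) * (\<rho> * N + N * \<rho>) + cmod (a 0) * (N * \<rho>) + N * (N * (2 * N * V / \<bar>s\<bar>)))"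
    by (rule norm_triangle_le_diff[OF add_mono]; intro norm_triangle_mono n1 n2 n3 n4 n5 n6)
  also have "\<dots> = V * (\<delta>\<^sup>2 / 2) + (3 * cmod (b 0) + cmod (a 0)) * (N * \<rho>) + V * (4 * N ^ 3 / \<bar>s\<bar>)"
    by (simp add: algebra_simps power3_eq_cube)
  also have "\<dots> \<le> V * \<delta>\<^sup>2 + (4 * V) * (N * \<rho>) + V * (4 * N ^ 3 / \<bar>s\<bar>)"
    using V_nonneg N_nonneg \<rho>0
    by (intro add_mono mult_right_mono mult_left_mono) (auto simp: V_def)
  also have "\<dots> = V * (\<delta>\<^sup>2 + 4 * N * \<rho> + 4 * N ^ 3 / \<bar>s\<bar>)"
    by (simp add: algebra_simps)
  finally have main: "cmod ((a 0 * pint P 1 + b 0 * pint R 1 + pint G 1)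
      - (b 0 * pint (\<lambda>t. e t * P t) 1 + a 0 * pint (\<lambda>t. e t * R' t) 1 + pint (\<lambda>t. e t * G' t) 1))
      \<le> V * (\<delta>\<^sup>2 + 4 * N * \<rho> + 4 * N ^ 3 / \<bar>s\<bar>)" .
  have "cmod \<kappa> = 1 / (2 * \<bar>s\<bar>)" by (simp add: \<kappa>_def norm_divide norm_mult)
  then show ?thesis
    unfolding secular_equation D1 norm_mult[of \<kappa>]
    using mult_left_mono[OF main, of "1 / (2 * \<bar>s\<bar>)"] by simp
qed

lemma N_le: "N \<le> integral {0..1} (\<lambda>x. \<bar>q x\<bar>) + \<bar>\<delta>\<bar>"
proof -
  have qi: "(\<lambda>x. \<bar>q x\<bar>) integrable_on {0..1}" using q by (simp add: absolutely_integrable_on_def)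
  have ci: "(\<lambda>x. \<bar>\<delta>\<bar>) integrable_on {0..1::real}" by auto
  have "N \<le> integral {0..1} (\<lambda>x. \<bar>q x\<bar> + \<bar>\<delta>\<bar>)"
    unfolding N_def by (intro integral_le p_abs_integrable integrable_add qi ci) (simp add: p_def abs_triangle_ineq4)
  then show ?thesis using Henstock_Kurzweil_Integration.integral_add[OF qi ci] by simp
qed

lemma reflect_data:
  "oscillation.a (- s) y u = b" "oscillation.b (- s) y u = a" "oscillation.V (- s) y u = V"
  "oscillation.c q (- s) = cnj c"
proof -
  interpret r: oscillation q \<delta> "- s" y u by (rule reflect)
  show ab: "r.a = b" "r.b = a" by (simp_all add: a_def b_def r.a_def r.b_def)
  show "r.V = V" by (simp add: V_def r.V_def ab)
  show "r.c = cnj c"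
    unfolding c_def r.c_def integral_cnj by (simp add: cis_cnj)
qed

text \<open>The crude secular equations bound \<open>\<bar>\<delta>\<bar>\<close> by \<open>cmod c + 4 * N\<^sup>2 / \<bar>s\<bar>\<close>, where \<open>N\<close> itself grows with
\<open>\<bar>\<delta>\<bar>\<close>. As soon as \<open>\<delta>\<close> is small against \<open>s\<close> the quadratic term in \<open>\<delta>\<close> is absorbed on the left, so an a
priori bound \<open>o(s)\<close> for \<open>\<delta>\<close> improves to \<open>o(1)\<close>, because \<open>c\<close> tends to zero.\<close>

lemma delta_bound:
  assumes V: "V > 0" and small: "N \<le> \<bar>s\<bar> / 2" and \<delta>: "16 * \<bar>\<delta>\<bar> \<le> \<bar>s\<bar>"
  shows "\<bar>\<delta>\<bar> \<le> 2 * cmod c + 16 * (integral {0..1} (\<lambda>x. \<bar>q x\<bar>))\<^sup>2 / \<bar>s\<bar>"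
proof -
  interpret r: oscillation q \<delta> "- s" y u by (rule reflect)
  note r = reflect_data
  define Q where "Q = integral {0..1} (\<lambda>x. \<bar>q x\<bar>)"
  define E where "E = 2 * N\<^sup>2 * V / \<bar>s\<bar>"
  have e1: "cmod (of_real \<delta> * a 0 - c * b 0) \<le> E"
    unfolding E_def by (rule secular_crude[OF small])
  have e2: "cmod (of_real \<delta> * b 0 - cnj c * a 0) \<le> E"
    using r.secular_crude small by (simp add: r E_def)
  have "\<bar>\<delta>\<bar> * cmod (a 0) \<le> cmod c * cmod (b 0) + E"
    using e1 norm_triangle_ineq2[of "of_real \<delta> * a 0" "c * b 0"] by (simp add: norm_mult)
  moreover have "\<bar>\<delta>\<bar> * cmod (b 0) \<le> cmod c * cmod (a 0) + E"
    using e2 norm_triangle_ineq2[of "of_real \<delta> * b 0" "cnj c * a 0"] by (simp add: norm_mult)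
  ultimately have "\<bar>\<delta>\<bar> * V \<le> cmod c * V + 2 * E"
    by (simp add: V_def algebra_simps)
  also have "\<dots> = (cmod c + 4 * N\<^sup>2 / \<bar>s\<bar>) * V"
    by (simp add: E_def algebra_simps)
  finally have 1: "\<bar>\<delta>\<bar> \<le> cmod c + 4 * N\<^sup>2 / \<bar>s\<bar>"
    using V by simp
  have "N\<^sup>2 \<le> (Q + \<bar>\<delta>\<bar>)\<^sup>2"
    using N_le N_nonneg by (intro power_mono) (auto simp: Q_def)
  also have "\<dots> \<le> 2 * Q\<^sup>2 + 2 * \<delta>\<^sup>2"
    using sum_squares_bound[of Q "\<bar>\<delta>\<bar>"] by (simp add: power2_sum)
  also have "2 * \<delta>\<^sup>2 \<le> 2 * (\<bar>\<delta>\<bar> * (\<bar>s\<bar> / 16))"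
    using mult_left_mono[OF \<delta>, of "\<bar>\<delta>\<bar>"] by (simp add: power2_eq_square flip: abs_mult)
  finally have "4 * N\<^sup>2 \<le> 8 * Q\<^sup>2 + \<bar>\<delta>\<bar> * \<bar>s\<bar> / 2" by simp
  then have "4 * N\<^sup>2 / \<bar>s\<bar> \<le> 8 * Q\<^sup>2 / \<bar>s\<bar> + \<bar>\<delta>\<bar> / 2"
    using s0 by (simp add: field_simps)
  with 1 show ?thesis by (simp add: Q_def)
qed

end

section \<open>The secular equation for high frequencies\<close>

definition freq :: "nat \<Rightarrow> real" where "freq n = pi * (2 * real n + 1)"

lemma freq_pos: "freq n > 0" and freq_ge: "real n \<le> freq n"
proof -
  show "freq n > 0" by (simp add: freq_def add_nonneg_pos)
  have "1 * real n \<le> pi * (2 * real n + 1)"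
    using pi_ge_two by (intro mult_mono) auto
  then show "real n \<le> freq n" by (simp add: freq_def)
qed

lemma freq_large: "\<forall>\<^sub>F n in sequentially. K * sqrt (real n) \<le> freq n \<and> K \<le> freq n"
proof -
  have "filterlim (\<lambda>n. sqrt (real n)) at_top sequentially"
    by (rule filterlim_compose[OF sqrt_at_top filterlim_real_sequentially])
  then have "\<forall>\<^sub>F n in sequentially. max K 1 \<le> sqrt (real n)"
    unfolding filterlim_at_top by blast
  then show ?thesis
  proof eventually_elim
    case (elim n)
    have "K * sqrt (real n) \<le> sqrt (real n) * sqrt (real n)"
      using elim by (intro mult_right_mono) auto
    moreover have "K \<le> sqrt (real n) * sqrt (real n)"
      using mult_mono[of K "sqrt (real n)" 1 "sqrt (real n)"] elim by auto
    ultimately show ?case using freq_ge[of n] by simp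
  qed
qed

lemma fourier_coeff_eq:
  "fourier_coeff q (2 * int n + 1) = integral {0..1} (\<lambda>x. of_real (q x) * cis (- (2 * freq n) * x))"
  unfolding fourier_coeff_def freq_def cis_conv_exp
  by (intro integral_cong arg_cong2[of _ _ _ _ "(*)"] arg_cong[of _ _ exp]) (auto simp: algebra_simps)

text \<open>To precision \<open>\<epsilon> / n\<close>, the initial amplitudes \<open>(a, b)\<close> form an eigenvector for the eigenvalue \<open>\<delta>\<close> of the
Hermitian matrix with zero diagonal and off-diagonal entries \<open>c\<close> and \<open>cnj c\<close>, whose eigenvalues are
\<open>cmod c\<close> and \<open>- cmod c\<close>; and \<open>y\<close> is close to the corresponding combination of exponentials.\<close>

definition secular_estimate ::
    "(real \<Rightarrow> real) \<Rightarrow> nat \<Rightarrow> real \<Rightarrow> real \<Rightarrow> (real \<Rightarrow> complex) \<Rightarrow> (real \<Rightarrow> complex) \<Rightarrow> bool" where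
  "secular_estimate q n \<epsilon> \<delta> y u \<longleftrightarrow>
     (let s = freq n; a = amplitude s y u 0; b = amplitude (- s) y u 0;
          c = fourier_coeff q (2 * int n + 1); V = cmod a + cmod b
      in cmod (of_real \<delta> * a - c * b) \<le> \<epsilon> / real n * V \<and>
         cmod (of_real \<delta> * b - cnj c * a) \<le> \<epsilon> / real n * V \<and>
         (\<forall>x\<in>{0..1}. cmod (y x - (a * cis (s * x) + b * cis (- s * x))) \<le> \<epsilon> * V))"

text \<open>Uniform in all solutions at once. The bound \<open>C * sqrt n\<close> first improves to \<open>\<bar>\<delta>\<bar> \<le> \<eta>\<close> by
\<open>delta_bound\<close>; then the Riemann-Lebesgue lemma supplies \<open>\<rho> = 2 * \<eta>\<close> in \<open>secular_refined\<close>.\<close>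

lemma asymptotic_secular:
  assumes q: "q absolutely_integrable_on {0..1}" and C: "C \<ge> 0" and \<epsilon>: "\<epsilon> > 0"
  shows "\<forall>\<^sub>F n in sequentially. \<forall>\<delta> y u. oscillation q \<delta> (freq n) y u \<longrightarrow>
           \<bar>\<delta>\<bar> \<le> C * sqrt (real n) \<longrightarrow> secular_estimate q n \<epsilon> \<delta> y u"
proof -
  define Q where "Q = integral {0..1} (\<lambda>x. \<bar>q x\<bar>)"
  have Q0: "Q \<ge> 0"
    unfolding Q_def using q by (intro integral_nonneg) (auto simp: absolutely_integrable_on_def)
  \<comment> \<open>\<open>B\<close> will bound \<open>N\<close>, the \<open>L\<^sub>1\<close> norm of \<open>q - \<delta>\<close>, once \<open>\<bar>\<delta>\<bar> \<le> \<eta> \<le> 1\<close> is known.\<close>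
  define B where "B = Q + 1"
  have B1: "B \<ge> 1" using Q0 by (simp add: B_def)
  define \<eta> where "\<eta> = min 1 (\<epsilon> / (9 * B))"
  have \<eta>: "\<eta> > 0" "\<eta> \<le> 1" "9 * B * \<eta> \<le> \<epsilon>"
  proof -
    show "\<eta> > 0" "\<eta> \<le> 1" using \<epsilon> B1 by (simp_all add: \<eta>_def)
    have "9 * B * \<eta> \<le> 9 * B * (\<epsilon> / (9 * B))" using B1 by (intro mult_left_mono) (auto simp: \<eta>_def)
    then show "9 * B * \<eta> \<le> \<epsilon>" using B1 by simp
  qed
  obtain S where S: "S > 0" and RL: "\<And>s x. S \<le> \<bar>s\<bar> \<Longrightarrow> x \<in> {0..1} \<Longrightarrow>
       cmod (integral {0..x} (\<lambda>t. of_real (q t) * cis (s * t))) \<le> \<eta> / 4"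
    using riemann_lebesgue_uniform[OF q, of "\<eta>/4"] \<eta> by auto
  \<comment> \<open>All terms of \<open>K\<close> are nonnegative, so a frequency above \<open>K\<close> and \<open>K * sqrt n\<close> exceeds each threshold met below.\<close>
  define K where "K = 4 * Q + 16 * C + 32 * Q\<^sup>2 / \<eta> + 4 * B ^ 3 / \<epsilon> + 2 * B / \<epsilon> + S"
  have "32 * Q\<^sup>2 / \<eta> \<ge> 0" "4 * B ^ 3 / \<epsilon> \<ge> 0" "2 * B / \<epsilon> \<ge> 0"
    using \<eta>(1) \<epsilon> B1 by simp_all
  then have K: "4 * Q \<le> K" "4 * C \<le> K" "16 * C \<le> K" "32 * Q\<^sup>2 / \<eta> \<le> K" "4 * B ^ 3 / \<epsilon> \<le> K" "2 * B / \<epsilon> \<le> K" "S \<le> K"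
    unfolding K_def using Q0 C S by linarith+
  show ?thesis
    using freq_large[of K] eventually_gt_at_top[of 0]
  proof eventually_elim
    case (elim n)
    define s where "s = freq n"
    have s: "s > 0" "K * sqrt (real n) \<le> s" "K \<le> s" "real n \<le> s" "real n > 0"
      using elim freq_pos freq_ge by (auto simp: s_def)
    have KC: "4 * C * sqrt (real n) \<le> s" "16 * C * sqrt (real n) \<le> s"
      by (rule order_trans[OF mult_right_mono[OF K(2)] s(2)] order_trans[OF mult_right_mono[OF K(3)] s(2)]; simp)+
    show ?case unfolding secular_estimate_def Let_def s_def[symmetric]
    proof (intro allI impI)
      fix \<delta> y u
      assume "oscillation q \<delta> s y u" and \<delta>: "\<bar>\<delta>\<bar> \<le> C * sqrt (real n)"
      then interpret oscillation q \<delta> s y u by simp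
      interpret r: oscillation q \<delta> "- s" y u by (rule reflect)
      note r = reflect_data
      have cF: "c = fourier_coeff q (2 * int n + 1)"
        unfolding c_def fourier_coeff_eq unfolding s_def ..
      have small: "N \<le> \<bar>s\<bar> / 2"
        using N_le \<delta> KC K(1) s by (simp add: Q_def)
      have goal: "cmod (of_real \<delta> * a 0 - c * b 0) \<le> \<epsilon> / real n * V \<and>
        cmod (of_real \<delta> * b 0 - cnj c * a 0) \<le> \<epsilon> / real n * V \<and>
        (\<forall>x\<in>{0..1}. cmod (y x - (a 0 * cis (s * x) + b 0 * cis (- s * x))) \<le> \<epsilon> * V)"
      proof (cases "V = 0")
        case True
        then have "a 0 = 0" "b 0 = 0" by (auto simp: V_def add_nonneg_eq_0_iff)
        then show ?thesis using y_bound[OF small] True by simp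
      next
        case False
        then have V: "V > 0" using V_nonneg by simp
        have "cmod c \<le> \<eta> / 4"
          unfolding c_def using RL[of "- (2 * s)" 1] K(7) s by auto
        moreover have "16 * Q\<^sup>2 / s \<le> \<eta> / 2"
        proof -
          have "32 * Q\<^sup>2 \<le> s * \<eta>"
            using order_trans[OF K(4) s(3)] \<eta> by (simp add: field_simps)
          then show ?thesis using s by (simp add: field_simps)
        qed
        moreover have "\<bar>\<delta>\<bar> \<le> 2 * cmod c + 16 * Q\<^sup>2 / s"
          using delta_bound[OF V small] \<delta> KC s by (simp add: Q_def)
        ultimately have d: "\<bar>\<delta>\<bar> \<le> \<eta>" by simp
        have NB: "N \<le> B" using N_le d \<eta> by (simp add: B_def Q_def)
        have \<rho>: "cmod (pint (\<lambda>t. cis (\<sigma> * t)) x) \<le> 2 * \<eta>"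
          if "x \<in> {0..1}" "\<bar>\<sigma>\<bar> = 2 * s" for x \<sigma>
          using pint_cis_bound[OF that(1), of \<sigma>] RL[of \<sigma> x] that K(7) s d \<eta> by auto
        have fin: "V / (2 * \<bar>s\<bar>) * (\<delta>\<^sup>2 + 4 * N * (2 * \<eta>) + 4 * N ^ 3 / \<bar>s\<bar>) \<le> \<epsilon> / real n * V"
        proof -
          have "\<delta>\<^sup>2 \<le> \<eta> * 1"
            using mult_mono[OF d, of "\<bar>\<delta>\<bar>" 1] d \<eta> by (simp add: power2_eq_square flip: abs_mult)
          also have "\<dots> \<le> \<eta> * B" using B1 \<eta> by (intro mult_left_mono) auto
          finally have t1: "\<delta>\<^sup>2 \<le> B * \<eta>" by (simp add: mult.commute)
          have t2: "4 * N * (2 * \<eta>) \<le> 8 * B * \<eta>" using NB \<eta> by simp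
          have "4 * N ^ 3 \<le> 4 * B ^ 3" using NB N_nonneg by (simp add: power_mono)
          also have "\<dots> \<le> \<epsilon> * s" using order_trans[OF K(5) s(3)] \<epsilon> by (simp add: field_simps)
          finally have t3: "4 * N ^ 3 / \<bar>s\<bar> \<le> \<epsilon>" using s by (simp add: field_simps)
          have "\<delta>\<^sup>2 + 4 * N * (2 * \<eta>) + 4 * N ^ 3 / \<bar>s\<bar> \<le> 2 * \<epsilon>"
            using t1 t2 t3 \<eta>(3) by linarith
          then have "V / (2 * \<bar>s\<bar>) * (\<delta>\<^sup>2 + 4 * N * (2 * \<eta>) + 4 * N ^ 3 / \<bar>s\<bar>) \<le> V / (2 * \<bar>s\<bar>) * (2 * \<epsilon>)"
            using V s by (intro mult_left_mono) auto
          also have "\<dots> = \<epsilon> / s * V" using s by simp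
          also have "\<dots> \<le> \<epsilon> / real n * V"
            using s V \<epsilon> by (intro mult_right_mono divide_left_mono) auto
          finally show ?thesis .
        qed
        have g1: "cmod (of_real \<delta> * a 0 - c * b 0) \<le> \<epsilon> / real n * V"
          by (rule order_trans[OF secular_refined[OF small \<rho> \<rho>] fin]) (use s in auto)
        have "cmod (of_real \<delta> * r.a 0 - r.c * r.b 0) \<le> r.V / (2 * \<bar>-s\<bar>) * (\<delta>\<^sup>2 + 4 * N * (2 * \<eta>) + 4 * N ^ 3 / \<bar>-s\<bar>)"
        proof (rule r.secular_refined)
          show "N \<le> \<bar>-s\<bar> / 2" using small by simp
          show "cmod (pint (\<lambda>t. cis (- (2 * - s) * t)) x) \<le> 2 * \<eta>" if "x \<in> {0..1}" for x
            by (rule \<rho>[OF that]) (use s in simp)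
          show "cmod (pint (\<lambda>t. cis (2 * - s * t)) x) \<le> 2 * \<eta>" if "x \<in> {0..1}" for x
            by (rule \<rho>[OF that]) (use s in simp)
        qed
        then have g2: "cmod (of_real \<delta> * b 0 - cnj c * a 0) \<le> \<epsilon> / real n * V"
          using fin by (simp add: r)
        have g3: "cmod (y x - (a 0 * cis (s * x) + b 0 * cis (- s * x))) \<le> \<epsilon> * V" if x: "x \<in> {0..1}" for x
        proof -
          have "y x - (a 0 * cis (s * x) + b 0 * cis (- s * x))
             = (a x - a 0) * cis (s * x) + (b x - b 0) * cis (- s * x)"
            using amplitude_decomposition[OF s0, of y x u] by (simp add: a_def b_def algebra_simps)
          also have "cmod \<dots> \<le> N * V / \<bar>s\<bar> + N * V / \<bar>s\<bar>"
            by (rule norm_triangle_mono) (use drift[OF small x] in \<open>simp_all add: norm_mult\<close>)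
          also have "\<dots> = 2 * N / s * V" using s by simp
          also have "\<dots> \<le> \<epsilon> * V"
          proof (rule mult_right_mono)
            have "2 * N \<le> 2 * B" using NB by simp
            also have "\<dots> \<le> \<epsilon> * s" using order_trans[OF K(6) s(3)] \<epsilon> by (simp add: field_simps)
            finally show "2 * N / s \<le> \<epsilon>" using s by (simp add: field_simps)
          qed (use V in auto)
          finally show ?thesis .
        qed
        show ?thesis using g1 g2 g3 by blast
      qed
      then show "cmod (of_real \<delta> * amplitude s y u 0 - fourier_coeff q (2 * int n + 1) * amplitude (- s) y u 0)
          \<le> \<epsilon> / real n * (cmod (amplitude s y u 0) + cmod (amplitude (- s) y u 0)) \<and>
        cmod (of_real \<delta> * amplitude (- s) y u 0 - cnj (fourier_coeff q (2 * int n + 1)) * amplitude s y u 0)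
          \<le> \<epsilon> / real n * (cmod (amplitude s y u 0) + cmod (amplitude (- s) y u 0)) \<and>
        (\<forall>x\<in>{0..1}. cmod (y x - (amplitude s y u 0 * cis (s * x) + amplitude (- s) y u 0 * cis (- s * x)))
          \<le> \<epsilon> * (cmod (amplitude s y u 0) + cmod (amplitude (- s) y u 0)))"
        unfolding cF a_def b_def V_def .
    qed
  qed
qed

section \<open>Eigenfunctions and their amplitudes\<close>

lemma eigenspace_solution:
  assumes q: "q absolutely_integrable_on {0..1}" and y: "y \<in> eigenspace q (of_real lam)"
  shows "\<exists>u. antiperiodic_solution q lam y u"
proof -
  obtain u u' where yu: "\<And>x. x \<in> {0..1} \<Longrightarrow> (y has_vector_derivative u x) (at x within {0..1})"
    and u: "abs_cont_with_deriv u u'" and bc: "y 1 = - y 0" "u 1 = - u 0"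
    and ae: "AE x in lebesgue. x \<in> {0..1} \<longrightarrow> of_real lam * y x = - u' x + of_real (q x) * y x"
    using y unfolding eigenspace_def antiperiodic_op_def by blast
  have ac: "abs_cont_with_deriv y u"
    using yu abs_cont_continuous[OF u] by (rule abs_cont_C1)
  have "(\<lambda>x. q x - lam) absolutely_integrable_on {0..1}"
    by (intro set_integral_diff(1) q absolutely_integrable_continuous_real continuous_intros)
  then have "(\<lambda>x. of_real (q x - lam) * y x) absolutely_integrable_on {0..1}"
    by (intro absolutely_integrable_mult_continuous absolutely_integrable_of_real abs_cont_continuous[OF ac])
  moreover have "AE x in lebesgue. x \<in> {0..1} \<longrightarrow> u' x = of_real (q x - lam) * y x"
    using ae by eventually_elim (auto simp: algebra_simps add_eq_0_iff)
  ultimately have "abs_cont_with_deriv u (\<lambda>x. of_real (q x - lam) * y x)"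
    by (rule abs_cont_cong_AE[OF u])
  with ac bc show ?thesis by (auto simp: antiperiodic_solution_def)
qed

lemma antiperiodic_solution_lincomb:
  assumes "antiperiodic_solution q lam y u" "antiperiodic_solution q lam z v"
  shows "antiperiodic_solution q lam (\<lambda>x. k * y x + l * z x) (\<lambda>x. k * u x + l * v x)"
proof -
  have "abs_cont_with_deriv (\<lambda>x. k * y x + l * z x) (\<lambda>x. k * u x + l * v x)"
    using assms by (intro abs_cont_add abs_cont_cmult) (auto simp: antiperiodic_solution_def)
  moreover have "abs_cont_with_deriv (\<lambda>x. k * u x + l * v x)
      (\<lambda>x. k * (of_real (q x - lam) * y x) + l * (of_real (q x - lam) * z x))"
    using assms by (intro abs_cont_add abs_cont_cmult) (auto simp: antiperiodic_solution_def)
  then have "abs_cont_with_deriv (\<lambda>x. k * u x + l * v x) (\<lambda>x. of_real (q x - lam) * (k * y x + l * z x))"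
    by (rule abs_cont_cong) (auto simp: algebra_simps)
  ultimately show ?thesis
    using assms by (auto simp: antiperiodic_solution_def)
qed

lemma amplitude_lincomb:
  "amplitude s (\<lambda>x. k * y x + l * z x) (\<lambda>x. k * u x + l * v x) t =
     k * amplitude s y u t + l * amplitude s z v t"
  by (simp add: amplitude_def add_divide_distrib algebra_simps)

text \<open>For real \<open>q\<close> the Wronskian of \<open>y\<close> and \<open>cnj z\<close> has derivative \<open>(l2 - l1) * y * cnj z\<close>, and it takes equal
values at 0 and 1 because both factors of each product change sign.\<close>

lemma eigenfunctions_orthogonal:
  assumes y: "antiperiodic_solution q l1 y u" and z: "antiperiodic_solution q l2 z v" and ne: "l1 \<noteq> l2"
  shows "((\<lambda>x. y x * cnj (z x)) has_integral 0) {0..1}"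
proof -
  have acs: "abs_cont_with_deriv y u" "abs_cont_with_deriv u (\<lambda>x. of_real (q x - l1) * y x)"
    "abs_cont_with_deriv z v" "abs_cont_with_deriv v (\<lambda>x. of_real (q x - l2) * z x)"
    and bc: "y 1 = - y 0" "u 1 = - u 0" "z 1 = - z 0" "v 1 = - v 0"
    using y z by (auto simp: antiperiodic_solution_def)
  have "abs_cont_with_deriv (\<lambda>x. u x * cnj (z x) + (- 1) * (y x * cnj (v x)))
     (\<lambda>x. (of_real (q x - l1) * y x * cnj (z x) + u x * cnj (v x))
        + (- 1) * (u x * cnj (v x) + y x * cnj (of_real (q x - l2) * z x)))"
    by (intro abs_cont_add abs_cont_cmult abs_cont_mult abs_cont_cnj acs)
  from abs_cont_integral[OF this, of 0 1]
  have "((\<lambda>x. of_real (l2 - l1) * (y x * cnj (z x))) has_integral 0) {0..1}"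
    by (simp add: bc algebra_simps)
  then have "((\<lambda>x. 1 / of_real (l2 - l1) * (of_real (l2 - l1) * (y x * cnj (z x)))) has_integral
      1 / of_real (l2 - l1) * 0) {0..1}"
    by (rule has_integral_mult_right)
  moreover have "1 / of_real (l2 - l1) * (of_real (l2 - l1) * w) = w" for w :: complex
    using ne by simp
  ultimately show ?thesis by (simp only:) simp
qed

lemma cis_freq: "cis (freq n) = - 1"
proof -
  have "freq n = pi + 2 * pi * real n" by (simp add: freq_def algebra_simps)
  then show ?thesis by (simp flip: cis_mult)
qed

lemma principal_part_product:
  assumes "cis s = - 1" "s \<noteq> 0"
  shows "((\<lambda>x. (a * cis (s * x) + b * cis (- s * x)) * cnj (c * cis (s * x) + d * cis (- s * x)))
           has_integral a * cnj c + b * cnj d) {0..1}"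
proof -
  have c2: "cis (2 * s) = 1" using assms cis_mult[of s s] by simp
  then have c2': "cis (- (2 * s)) = 1" using cis_inverse[of "2 * s"] by simp
  have I: "((\<lambda>x. cis (2 * s * x)) has_integral 0) {0..1}" "((\<lambda>x. cis (- (2 * s) * x)) has_integral 0) {0..1}"
    using assms c2 c2' by (intro cis_integral_zero; simp)+
  have const: "((\<lambda>x. w) has_integral w) {0..1::real}" for w :: complex
    using has_integral_const_real[of w 0 1] by simp
  have "((\<lambda>x. (a * cnj c + b * cnj d) + (a * cnj d * cis (2 * s * x) + b * cnj c * cis (- (2 * s) * x))) has_integral
      (a * cnj c + b * cnj d) + (a * cnj d * 0 + b * cnj c * 0)) {0..1}"
    by (rule has_integral_add[OF const has_integral_add[OF has_integral_mult_right[OF I(1)] has_integral_mult_right[OF I(2)]]])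
  moreover have "(a * cis (s * x) + b * cis (- s * x)) * cnj (c * cis (s * x) + d * cis (- s * x))
     = (a * cnj c + b * cnj d) + (a * cnj d * cis (2 * s * x) + b * cnj c * cis (- (2 * s) * x))" for x
  proof -
    define E where "E = cis (s * x)"
    define F where "F = cis (- s * x)"
    have EF: "E * F = 1" "cnj E = F" "cnj F = E" "cis (2 * s * x) = E * E" "cis (- (2 * s) * x) = F * F"
      by (simp_all add: E_def F_def cis_cnj cis_mult algebra_simps)
    have "(a * E + b * F) * cnj (c * E + d * F)
        = a * cnj c * (E * F) + b * cnj d * (E * F) + (a * cnj d * (E * E) + b * cnj c * (F * F))"
      by (simp add: EF(2,3) algebra_simps)
    then show ?thesis unfolding EF(1,4,5) E_def[symmetric] F_def[symmetric] by simp
  qed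
  ultimately show ?thesis by simp
qed

text \<open>The exponentials \<open>cis (s * x)\<close> and \<open>cis (- s * x)\<close> are orthonormal, so orthogonality of the eigenfunctions
passes to their amplitude vectors up to the approximation error.\<close>

lemma near_orthogonal_amplitudes:
  assumes y: "antiperiodic_solution q l1 y u" and z: "antiperiodic_solution q l2 z v" and ne: "l1 \<noteq> l2"
    and s: "cis s = - 1" "s \<noteq> 0" and \<epsilon>: "0 \<le> \<epsilon>" "\<epsilon> \<le> 1"
    and ya: "\<And>x. x \<in> {0..1} \<Longrightarrow> cmod (y x - (a * cis (s * x) + b * cis (- s * x))) \<le> \<epsilon> * (cmod a + cmod b)"
    and zc: "\<And>x. x \<in> {0..1} \<Longrightarrow> cmod (z x - (c * cis (s * x) + d * cis (- s * x))) \<le> \<epsilon> * (cmod c + cmod d)"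
  shows "cmod (a * cnj c + b * cnj d) \<le> 3 * \<epsilon> * ((cmod a + cmod b) * (cmod c + cmod d))"
proof -
  define V where "V = cmod a + cmod b"
  define W where "W = cmod c + cmod d"
  have VW: "V \<ge> 0" "W \<ge> 0" by (simp_all add: V_def W_def)
  define Y where "Y x = a * cis (s * x) + b * cis (- s * x)" for x
  define Z where "Z x = c * cis (s * x) + d * cis (- s * x)" for x
  have YV: "cmod (Y x) \<le> V" for x
    unfolding Y_def V_def by (rule order_trans[OF norm_triangle_ineq]) (simp add: norm_mult)
  have ZW: "cmod (Z x) \<le> W" for x
    unfolding Z_def W_def by (rule order_trans[OF norm_triangle_ineq]) (simp add: norm_mult)
  have J: "((\<lambda>x. Y x * cnj (Z x) - y x * cnj (z x)) has_integral (a * cnj c + b * cnj d) - 0) {0..1}"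
    unfolding Y_def Z_def
    by (intro has_integral_diff principal_part_product s eigenfunctions_orthogonal[OF y z ne])
  have "cmod ((a * cnj c + b * cnj d) - 0) \<le> (3 * \<epsilon> * (V * W)) * Henstock_Kurzweil_Integration.content {0..1::real}"
  proof (rule has_integral_bound_real[OF _ finite.emptyI J])
    show "cmod (Y x * cnj (Z x) - y x * cnj (z x)) \<le> 3 * \<epsilon> * (V * W)" if "x \<in> {0..1} - {}" for x
    proof -
      have x: "x \<in> {0..1}" using that by simp
      have f: "cmod (y x - Y x) \<le> \<epsilon> * V" and g: "cmod (z x - Z x) \<le> \<epsilon> * W"
        using ya[OF x] zc[OF x] by (simp_all add: Y_def Z_def V_def W_def)
      have "cmod (z x) \<le> W + \<epsilon> * W"
        using norm_triangle_mono[OF ZW[of x] g] by simp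
      also have "\<dots> \<le> 2 * W" using \<epsilon> VW mult_right_mono[of \<epsilon> 1 W] by simp
      finally have zW: "cmod (z x) \<le> 2 * W" .
      have "Y x * cnj (Z x) - y x * cnj (z x) = - ((y x - Y x) * cnj (z x) + Y x * cnj (z x - Z x))"
        by (simp add: algebra_simps)
      also have "cmod \<dots> \<le> \<epsilon> * V * (2 * W) + V * (\<epsilon> * W)"
        unfolding norm_minus_cancel
        by (rule norm_triangle_mono; unfold norm_mult complex_mod_cnj; intro mult_mono f g zW YV)
          (use VW \<epsilon> in auto)
      also have "\<dots> = 3 * \<epsilon> * (V * W)" by (simp add: algebra_simps)
      finally show ?thesis .
    qed
    show "0 \<le> 3 * \<epsilon> * (V * W)" using VW \<epsilon> by simp
  qed
  then show ?thesis by (simp add: V_def W_def)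
qed

text \<open>Suppose \<open>\<delta>1\<close> and \<open>\<delta>2\<close> had the same sign. Multiplying \<open>\<delta>1 * a \<approx> k * b\<close> with the conjugate of
\<open>\<delta>2 * c \<approx> k * d\<close> and dividing by \<open>\<delta>1 * \<delta>2 \<approx> (cmod k)\<^sup>2\<close> gives \<open>a * cnj c \<approx> b * cnj d\<close>, while near orthogonality
gives \<open>a * cnj c \<approx> - b * cnj d\<close>. Then \<open>a * cnj c\<close> is small, although \<open>\<delta>1 * a \<approx> k * b\<close> forces \<open>a\<close> to carry
about half of \<open>V\<close>, and likewise \<open>c\<close> about half of \<open>W\<close>.\<close>

lemma opposite_signs_of_near_orthogonal:
  fixes a b c d k :: complex and \<delta>1 \<delta>2 \<tau> :: real
  defines "V \<equiv> cmod a + cmod b" and "W \<equiv> cmod c + cmod d"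
  assumes V: "V > 0" and W: "W > 0" and k: "k \<noteq> 0" and \<tau>: "0 \<le> \<tau>" "100 * \<tau> \<le> cmod k"
    and \<delta>1: "\<bar>\<bar>\<delta>1\<bar> - cmod k\<bar> \<le> 2 * \<tau>" and \<delta>2: "\<bar>\<bar>\<delta>2\<bar> - cmod k\<bar> \<le> 2 * \<tau>"
    and ab: "cmod (of_real \<delta>1 * a - k * b) \<le> \<tau> * V" "cmod (of_real \<delta>1 * b - cnj k * a) \<le> \<tau> * V"
    and cd: "cmod (of_real \<delta>2 * c - k * d) \<le> \<tau> * W" "cmod (of_real \<delta>2 * d - cnj k * c) \<le> \<tau> * W"
    and orth: "cmod (a * cnj c + b * cnj d) \<le> V * W / 10"
  shows "\<delta>1 * \<delta>2 \<le> 0"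
proof (rule ccontr)
  assume "\<not> \<delta>1 * \<delta>2 \<le> 0"
  then have pos: "\<delta>1 * \<delta>2 = \<bar>\<delta>1\<bar> * \<bar>\<delta>2\<bar>" by (simp add: abs_mult flip: abs_mult)
  define r where "r = cmod k"
  have r: "r > 0" using k by (simp add: r_def)
  have d1: "\<bar>\<delta>1\<bar> \<le> 102/100 * r" "98/100 * r \<le> \<bar>\<delta>1\<bar>" and d2: "\<bar>\<delta>2\<bar> \<le> 102/100 * r" "98/100 * r \<le> \<bar>\<delta>2\<bar>"
    using \<delta>1 \<delta>2 \<tau> by (auto simp: r_def)
  have half: "49/100 * (cmod x + cmod y) \<le> cmod x"
    if "cmod (of_real \<delta> * x - k * y) \<le> \<tau> * (cmod x + cmod y)" "\<bar>\<delta>\<bar> \<le> 102/100 * r" for \<delta> x y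
  proof -
    have "r * cmod y \<le> \<bar>\<delta>\<bar> * cmod x + \<tau> * (cmod x + cmod y)"
      using that(1) norm_triangle_ineq2[of "k * y" "of_real \<delta> * x"]
      by (simp add: norm_mult norm_minus_commute r_def)
    also have "\<dots> \<le> 102/100 * r * cmod x + r/100 * (cmod x + cmod y)"
      using that(2) \<tau> by (intro add_mono mult_right_mono) (auto simp: r_def)
    finally have "r * cmod y \<le> r * (103/100 * cmod x + 1/100 * cmod y)"
      by (simp add: algebra_simps add_divide_distrib)
    then have "cmod y \<le> 103/100 * cmod x + 1/100 * cmod y" using r by simp
    then have "99 * cmod y \<le> 103 * cmod x" by simp
    then have "49 * cmod y \<le> 51 * cmod x" using norm_ge_zero[of x] by linarith
    then show ?thesis by simp
  qed
  have aV: "49/100 * V \<le> cmod a" and cW: "49/100 * W \<le> cmod c"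
    unfolding V_def W_def
    by (rule half[OF ab(1)[unfolded V_def] d1(1)] half[OF cd(1)[unfolded W_def] d2(1)])+
  have le: "cmod a \<le> V" "cmod b \<le> V" "cmod c \<le> W" by (simp_all add: V_def W_def)
  define X where "X = of_real (\<delta>1 * \<delta>2) * (a * cnj c) - of_real (r\<^sup>2) * (b * cnj d)"
  have kk: "k * cnj k = of_real (r\<^sup>2)" unfolding r_def by (rule complex_norm_square[symmetric])
  have X: "X = (of_real \<delta>1 * a - k * b) * (of_real \<delta>2 * cnj c) + k * b * cnj (of_real \<delta>2 * c - k * d)"
    unfolding X_def kk[symmetric] by (simp add: algebra_simps)
  have \<tau>r: "\<tau> \<le> r / 100" using \<tau> by (simp add: r_def)
  have "cmod X \<le> (r/100 * V) * (102/100 * r * W) + r * V * (r/100 * W)"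
    unfolding X
  proof (rule norm_triangle_mono)
    have "cmod (of_real \<delta>1 * a - k * b) \<le> r/100 * V"
      using order_trans[OF ab(1) mult_right_mono[OF \<tau>r]] V by simp
    moreover have "cmod (of_real \<delta>2 * cnj c) \<le> 102/100 * r * W"
      unfolding norm_mult complex_mod_cnj norm_of_real using d2 le r by (intro mult_mono) auto
    ultimately show "cmod ((of_real \<delta>1 * a - k * b) * (of_real \<delta>2 * cnj c)) \<le> (r/100 * V) * (102/100 * r * W)"
      unfolding norm_mult[of "_ - _"] using r V by (intro mult_mono) auto
    have "cmod (of_real \<delta>2 * c - k * d) \<le> r/100 * W"
      using order_trans[OF cd(1) mult_right_mono[OF \<tau>r]] W by simp
    moreover have "cmod (k * b) \<le> r * V"
      unfolding norm_mult r_def using le by (intro mult_mono) auto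
    ultimately show "cmod (k * b * cnj (of_real \<delta>2 * c - k * d)) \<le> r * V * (r/100 * W)"
      unfolding norm_mult[of "k * b"] complex_mod_cnj using r V by (intro mult_mono) auto
  qed
  also have "\<dots> = 202/10000 * (r\<^sup>2 * (V * W))" by (simp add: power2_eq_square)
  finally have X1: "cmod X \<le> 202/10000 * (r\<^sup>2 * (V * W))" .
  have "\<delta>1 * \<delta>2 \<le> (102/100 * r) * (102/100 * r)" "(98/100 * r) * (98/100 * r) \<le> \<delta>1 * \<delta>2"
    unfolding pos using d1 d2 r by (intro mult_mono; simp)+
  then have "\<delta>1 * \<delta>2 \<le> 10404/10000 * r\<^sup>2" "9604/10000 * r\<^sup>2 \<le> \<delta>1 * \<delta>2"
    by (simp_all add: power2_eq_square)
  then have "\<bar>\<delta>1 * \<delta>2 - r\<^sup>2\<bar> \<le> 404/10000 * r\<^sup>2"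
    using zero_le_power2[of r] by (intro abs_leI; linarith)
  moreover have "cmod (a * cnj c) \<le> V * W"
    unfolding norm_mult complex_mod_cnj using le V by (intro mult_mono) auto
  ultimately have X2: "cmod (of_real (\<delta>1 * \<delta>2 - r\<^sup>2) * (a * cnj c)) \<le> 404/10000 * r\<^sup>2 * (V * W)"
    unfolding norm_mult[of "of_real _"] norm_of_real by (intro mult_mono) auto
  have "of_real (r\<^sup>2) * (a * cnj c - b * cnj d) = X - of_real (\<delta>1 * \<delta>2 - r\<^sup>2) * (a * cnj c)"
    by (simp add: X_def algebra_simps)
  then have "r\<^sup>2 * cmod (a * cnj c - b * cnj d) = cmod (X - of_real (\<delta>1 * \<delta>2 - r\<^sup>2) * (a * cnj c))"
    by (metis norm_mult norm_of_real abs_of_nonneg zero_le_power2)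
  also have "\<dots> \<le> 202/10000 * (r\<^sup>2 * (V * W)) + 404/10000 * r\<^sup>2 * (V * W)"
    by (rule norm_triangle_le_diff[OF add_mono[OF X1 X2]])
  also have "\<dots> = r\<^sup>2 * (606/10000 * (V * W))" by (simp add: algebra_simps)
  finally have "cmod (a * cnj c - b * cnj d) \<le> 606/10000 * (V * W)"
    using r by simp
  from norm_triangle_mono[OF this orth]
  have "2 * cmod (a * cnj c) \<le> 1606/10000 * (V * W)"
    by (simp add: norm_mult flip: mult_2)
  moreover have "(49/100 * V) * (49/100 * W) \<le> cmod a * cmod c"
    using aV cW V W by (intro mult_mono) auto
  moreover have "V * W > 0" using V W by simp
  ultimately show False by (simp add: norm_mult)
qed

text \<open>With vanishing initial amplitudes the approximation of \<open>y\<close> by exponentials has error zero: for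
large \<open>n\<close> this is the uniqueness theorem for the initial value problem.\<close>

lemma secular_estimate_nontrivial:
  assumes est: "secular_estimate q n \<epsilon> \<delta> y u" and y: "x \<in> {0..1}" "y x \<noteq> 0"
  shows "cmod (amplitude (freq n) y u 0) + cmod (amplitude (- freq n) y u 0) > 0"
proof (rule ccontr)
  assume "\<not> ?thesis"
  then have z: "amplitude (freq n) y u 0 = 0" "amplitude (- freq n) y u 0 = 0"
    by (auto simp: not_less add_nonneg_eq_0_iff simp flip: norm_le_zero_iff)
      (smt (verit) norm_ge_zero)+
  show False
    using est y unfolding secular_estimate_def Let_def z by auto
qed

text \<open>The reverse triangle inequality in both components, added up: the common factor is
\<open>cmod a + cmod b\<close>.\<close>

lemma secular_estimate_abs:
  assumes est: "secular_estimate q n \<epsilon> \<delta> y u"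
    and V: "cmod (amplitude (freq n) y u 0) + cmod (amplitude (- freq n) y u 0) > 0"
  shows "\<bar>\<bar>\<delta>\<bar> - cmod (fourier_coeff q (2 * int n + 1))\<bar> \<le> 2 * (\<epsilon> / real n)"
proof -
  define a where "a = amplitude (freq n) y u 0"
  define b where "b = amplitude (- freq n) y u 0"
  define c where "c = fourier_coeff q (2 * int n + 1)"
  define \<tau> where "\<tau> = \<epsilon> / real n"
  define V where "V = cmod a + cmod b"
  have e: "cmod (of_real \<delta> * a - c * b) \<le> \<tau> * V" "cmod (of_real \<delta> * b - cnj c * a) \<le> \<tau> * V"
    using est by (auto simp: secular_estimate_def Let_def a_def b_def c_def \<tau>_def V_def)
  have "\<bar>cmod (of_real \<delta> * a) - cmod (c * b)\<bar> \<le> \<tau> * V" "\<bar>cmod (of_real \<delta> * b) - cmod (cnj c * a)\<bar> \<le> \<tau> * V"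
    using order_trans[OF norm_triangle_ineq3 e(1)] order_trans[OF norm_triangle_ineq3 e(2)] .
  then have "\<bar>\<bar>\<delta>\<bar> * V - cmod c * V\<bar> \<le> 2 * \<tau> * V"
    by (simp add: norm_mult V_def algebra_simps abs_le_iff)
  moreover have "V > 0" using V by (simp add: V_def a_def b_def)
  then have "\<bar>\<bar>\<delta>\<bar> * V - cmod c * V\<bar> = \<bar>\<bar>\<delta>\<bar> - cmod c\<bar> * V"
    by (metis abs_mult abs_of_pos left_diff_distrib)
  ultimately have "\<bar>\<bar>\<delta>\<bar> - cmod c\<bar> * V \<le> 2 * \<tau> * V" by simp
  then show ?thesis
    unfolding c_def[symmetric] \<tau>_def[symmetric] using \<open>V > 0\<close> by (rule mult_right_le_imp_le)
qed

text \<open>In a two-dimensional eigenspace every pair of initial amplitudes occurs, in particular \<open>(1, 0)\<close>; for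
that pair the second secular equation reads \<open>cmod c \<le> \<epsilon> / n\<close>. So all eigenfunctions have proportional
amplitudes, and by \<open>secular_estimate_nontrivial\<close> they are themselves proportional.\<close>

lemma eigenvalue_simple:
  assumes q: "q absolutely_integrable_on {0..1}"
    and est: "\<And>y u. antiperiodic_solution q lam y u \<Longrightarrow> secular_estimate q n \<epsilon> \<delta> y u"
    and gap: "\<epsilon> / real n < cmod (fourier_coeff q (2 * int n + 1))"
    and ev: "is_eigenvalue q (of_real lam)"
  shows "simple_eigenvalue q (of_real lam)"
proof -
  obtain y where y: "y \<in> eigenspace q (of_real lam)" "y \<noteq> 0"
    using ev by (auto simp: is_eigenvalue_def)
  obtain u where u: "antiperiodic_solution q lam y u"
    using eigenspace_solution[OF q y(1)] by blast
  define a where "a = amplitude (freq n) y u 0"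
  define b where "b = amplitude (- freq n) y u 0"
  obtain x where x: "y x \<noteq> 0" using y(2) by (auto simp: fun_eq_iff)
  then have "x \<in> {0..1}" using y(1) by (auto simp: eigenspace_def)
  from secular_estimate_nontrivial[OF est[OF u] this x] have ab: "a \<noteq> 0 \<or> b \<noteq> 0"
    by (auto simp: a_def b_def)
  have mult: "\<exists>k. z = (\<lambda>x. k * y x)" if z: "z \<in> eigenspace q (of_real lam)" for z
  proof -
    obtain v where v: "antiperiodic_solution q lam z v"
      using eigenspace_solution[OF q z] by blast
    define a' where "a' = amplitude (freq n) z v 0"
    define b' where "b' = amplitude (- freq n) z v 0"
    note comb = est[OF antiperiodic_solution_lincomb[OF u v], unfolded secular_estimate_def Let_def amplitude_lincomb,
        folded a_def b_def a'_def b'_def]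
    have det: "a * b' - b * a' = 0"
    proof (rule ccontr)
      define d where "d = a * b' - b * a'"
      assume "a * b' - b * a' \<noteq> 0"
      then have d: "d \<noteq> 0" by (simp add: d_def)
      \<comment> \<open>Cramer's rule for the combination of \<open>y\<close> and \<open>z\<close> with initial amplitudes \<open>(1, 0)\<close>.\<close>
      have "b' / d * a + (- b / d) * a' = (a * b' - b * a') / d"
        by (simp add: diff_divide_distrib mult.commute)
      then have 1: "b' / d * a + (- b / d) * a' = 1" using d by (simp add: d_def)
      have 2: "b' / d * b + (- b / d) * b' = 0" by simp
      have "cmod (of_real \<delta> * 0 - cnj (fourier_coeff q (2 * int n + 1)) * 1) \<le> \<epsilon> / real n * (cmod (1::complex) + cmod 0)"
        using comb[of "b' / d" "- b / d"] unfolding 1 2 by blast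
      then show False using gap by simp
    qed
    obtain k where k: "a' = k * a" "b' = k * b"
    proof (cases "a = 0")
      case True
      then have "b \<noteq> 0" using ab by simp
      then show ?thesis using det True by (intro that[of "b' / b"]) auto
    next
      case False
      then show ?thesis using det by (intro that[of "a' / a"]) (auto simp: field_simps)
    qed
    have "z x = k * y x" for x
    proof (cases "x \<in> {0..1}")
      case True
      have "- k * a + 1 * a' = 0" "- k * b + 1 * b' = 0" by (simp_all add: k)
      then show ?thesis
        using comb[of "- k" 1] True by (simp add: norm_le_zero_iff)
    next
      case False
      then show ?thesis using y(1) z by (auto simp: eigenspace_def)
    qed
    then show ?thesis by blast
  qed
  have "cfun.dim (eigenspace q (of_real lam)) = 1"
  proof (rule cfun.dim_unique[where B="{y}"])
    show "{y} \<subseteq> eigenspace q (of_real lam)" using y by simp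
    show "eigenspace q (of_real lam) \<subseteq> cfun.span {y}"
      using mult by (auto simp: cfun.span_singleton)
    show "\<not> cfun.dependent {y}" using y(2) by (simp add: cfun.dependent_single)
  qed simp
  then show ?thesis using ev by (simp add: simple_eigenvalue_def multiplicity_ev_def)
qed

text \<open>The list contains every eigenvalue as often as its multiplicity, so a coincidence
\<open>mu n 1 = mu n 2\<close> would make the multiplicity at least two. The count is a cardinality and says this
only for a finite set of indices, whence the role of \<open>unbounded\<close>.\<close>

lemma simple_eigenvalues_distinct:
  assumes mu: "large_eigenvalues q N0 mu" and n: "n \<ge> N0"
    and simple: "simple_eigenvalue q (of_real (mu n 1))"
    and unbounded: "\<And>L j. j \<in> {1,2} \<Longrightarrow> \<forall>\<^sub>F n in sequentially. L < mu n j"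
  shows "mu n 1 \<noteq> mu n 2"
proof
  assume eq: "mu n 1 = mu n 2"
  define lam where "lam = complex_of_real (mu n 1)"
  define A where "A = {(n, j). N0 \<le> n \<and> j \<in> {1,2} \<and> complex_of_real (mu n j) = lam}"
  obtain R where "card A = (if R < cmod lam then multiplicity_ev q lam else 0)"
    using mu unfolding large_eigenvalues_def A_def by blast
  then have "card A \<le> 1" using simple by (auto simp: simple_eigenvalue_def lam_def split: if_splits)
  have "\<forall>\<^sub>F n' in sequentially. mu n 1 < mu n' 1 \<and> mu n 1 < mu n' 2"
    using unbounded by (intro eventually_conj) auto
  then obtain M where M: "\<And>n'. n' \<ge> M \<Longrightarrow> mu n 1 < mu n' 1 \<and> mu n 1 < mu n' 2"
    by (auto simp: eventually_sequentially)
  have "A \<subseteq> {..<M} \<times> {1,2}"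
  proof (intro subsetI)
    fix p assume "p \<in> A"
    then obtain n' j where p: "p = (n', j)" "j \<in> {1,2}" "mu n' j = mu n 1"
      by (auto simp: A_def lam_def)
    then have "n' < M" using M[of n'] by (cases "M \<le> n'") auto
    then show "p \<in> {..<M} \<times> {1,2}" using p by auto
  qed
  then have fin: "finite A" by (rule finite_subset) auto
  have "{(n, 1), (n, 2)} \<subseteq> A" using n eq by (auto simp: A_def lam_def)
  from card_mono[OF fin this] have "2 \<le> card A" by simp
  with \<open>card A \<le> 1\<close> show False by simp
qed

section \<open>Asymptotics of the eigenvalues\<close>

lemma freq_square: "(2 * pi * real n + pi)\<^sup>2 = (freq n)\<^sup>2"
  by (simp add: freq_def algebra_simps)

locale antiperiodic_spectrum =
  fixes q :: "real \<Rightarrow> real" and N0 :: nat and mu :: "nat \<Rightarrow> nat \<Rightarrow> real"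
  assumes q: "q absolutely_integrable_on {0..1}" and mean: "integral {0..1} q = 0"
    and mu: "large_eigenvalues q N0 mu"
begin

text \<open>Both eigenvalues are measured from the unperturbed double eigenvalue \<open>(freq n)\<^sup>2\<close>.\<close>

definition shift :: "nat \<Rightarrow> nat \<Rightarrow> real" where "shift n j = mu n j - (freq n)\<^sup>2"
definition coeff :: "nat \<Rightarrow> complex" where "coeff n = fourier_coeff q (2 * int n + 1)"

lemma crude_localisation:
  obtains C where "C \<ge> 0" "\<forall>\<^sub>F n in sequentially. \<forall>j\<in>{1,2}. \<bar>shift n j\<bar> \<le> C * sqrt (real n)"
proof -
  have O: "(\<lambda>n. shift n j) \<in> O(\<lambda>n. sqrt (real n))" if "j \<in> {1,2}" for j
    using mu that unfolding large_eigenvalues_def shift_def freq_square by blast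
  obtain C1 where 1: "C1 > 0" "\<forall>\<^sub>F n in sequentially. norm (shift n 1) \<le> C1 * norm (sqrt (real n))"
    using landau_o.bigE[OF O[of 1]] by auto
  obtain C2 where 2: "C2 > 0" "\<forall>\<^sub>F n in sequentially. norm (shift n 2) \<le> C2 * norm (sqrt (real n))"
    using landau_o.bigE[OF O[of 2]] by auto
  show ?thesis
  proof (rule that[of "C1 + C2"])
    show "\<forall>\<^sub>F n in sequentially. \<forall>j\<in>{1,2}. \<bar>shift n j\<bar> \<le> (C1 + C2) * sqrt (real n)"
      using 1(2) 2(2)
    proof eventually_elim
      case (elim n)
      have "C1 * sqrt (real n) \<le> (C1 + C2) * sqrt (real n)" "C2 * sqrt (real n) \<le> (C1 + C2) * sqrt (real n)"
        using 1(1) 2(1) by (intro mult_right_mono; simp)+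
      then show ?case using elim by auto
    qed
  qed (use 1 2 in simp)
qed

lemma eventually_secular_estimate:
  assumes \<epsilon>: "\<epsilon> > 0"
  shows "\<forall>\<^sub>F n in sequentially. \<forall>j\<in>{1,2}. \<forall>y u. antiperiodic_solution q (mu n j) y u \<longrightarrow>
           secular_estimate q n \<epsilon> (shift n j) y u"
proof -
  obtain C where C: "C \<ge> 0" "\<forall>\<^sub>F n in sequentially. \<forall>j\<in>{1,2}. \<bar>shift n j\<bar> \<le> C * sqrt (real n)"
    by (rule crude_localisation)
  show ?thesis
    using C(2) asymptotic_secular[OF q C(1) \<epsilon>]
  proof eventually_elim
    case (elim n)
    show ?case
    proof (intro ballI allI impI)
      fix j :: nat and y u
      assume j: "j \<in> {1,2}" and "antiperiodic_solution q (mu n j) y u"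
      then have "oscillation q (shift n j) (freq n) y u"
        using q mean freq_pos[of n] cis_freq[of n] by unfold_locales (auto simp: shift_def)
      then show "secular_estimate q n \<epsilon> (shift n j) y u" using elim j by blast
    qed
  qed
qed

lemma eigenvalues_unbounded:
  assumes j: "j \<in> {1,2}"
  shows "\<forall>\<^sub>F n in sequentially. L < mu n j"
proof -
  obtain C where C: "C \<ge> 0" "\<forall>\<^sub>F n in sequentially. \<forall>j\<in>{1,2}. \<bar>shift n j\<bar> \<le> C * sqrt (real n)"
    by (rule crude_localisation)
  define K where "K = C + \<bar>L\<bar> + 2"
  show ?thesis
    using C(2) freq_large[of K]
  proof eventually_elim
    case (elim n)
    have K2: "K \<ge> 2" "C \<le> K" using C(1) by (simp_all add: K_def)
    have "C * sqrt (real n) \<le> K * sqrt (real n)" using K2 by (intro mult_right_mono) auto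
    then have "\<bar>shift n j\<bar> \<le> freq n" using elim j by force
    then have "(freq n)\<^sup>2 - freq n \<le> mu n j" by (simp add: shift_def abs_le_iff)
    moreover have "1 * (K - 1) \<le> freq n * (freq n - 1)"
      using elim K2 by (intro mult_mono) auto
    ultimately show ?case using C(1) by (simp add: K_def power2_eq_square algebra_simps)
  qed
qed

lemma eigenfunction_exists:
  assumes "n \<ge> N0" "j \<in> {1,2}"
  obtains y u x where "antiperiodic_solution q (mu n j) y u" "x \<in> {0..1}" "y x \<noteq> 0"
proof -
  have "is_eigenvalue q (of_real (mu n j))"
    using mu assms unfolding large_eigenvalues_def by blast
  then obtain y where y: "y \<in> eigenspace q (of_real (mu n j))" "y \<noteq> 0"
    by (auto simp: is_eigenvalue_def)
  obtain u where u: "antiperiodic_solution q (mu n j) y u"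
    using eigenspace_solution[OF q y(1)] by blast
  obtain x where x: "y x \<noteq> 0" using y(2) by (auto simp: fun_eq_iff)
  then have "x \<in> {0..1}" using y(1) by (auto simp: eigenspace_def)
  then show ?thesis using that u x by blast
qed

lemma shift_abs:
  assumes \<epsilon>: "\<epsilon> > 0"
  shows "\<forall>\<^sub>F n in sequentially. \<forall>j\<in>{1,2}. \<bar>\<bar>shift n j\<bar> - cmod (coeff n)\<bar> \<le> \<epsilon> / real n"
proof -
  have "\<epsilon> / 2 > 0" using \<epsilon> by simp
  from eventually_secular_estimate[OF this] eventually_ge_at_top[of N0] show ?thesis
  proof eventually_elim
    case (elim n)
    show ?case
    proof
      fix j :: nat assume j: "j \<in> {1,2}"
      obtain y u x where y: "antiperiodic_solution q (mu n j) y u" "x \<in> {0..1}" "y x \<noteq> 0"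
        using eigenfunction_exists[OF elim(2) j] .
      have est: "secular_estimate q n (\<epsilon>/2) (shift n j) y u" using elim(1) j y(1) by blast
      from secular_estimate_abs[OF est secular_estimate_nontrivial[OF est y(2,3)]]
      show "\<bar>\<bar>shift n j\<bar> - cmod (coeff n)\<bar> \<le> \<epsilon> / real n" by (simp add: coeff_def)
    qed
  qed
qed

lemma eventually_simple:
  assumes \<epsilon>: "\<epsilon> > 0"
  shows "\<forall>\<^sub>F n in sequentially. \<epsilon> / real n \<le> cmod (coeff n) \<longrightarrow>
           (\<forall>j\<in>{1,2}. simple_eigenvalue q (of_real (mu n j)))"
proof -
  have "\<epsilon> / 2 > 0" using \<epsilon> by simp
  from eventually_secular_estimate[OF this] eventually_ge_at_top[of N0] eventually_gt_at_top[of 0]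
  show ?thesis
  proof eventually_elim
    case (elim n)
    show ?case
    proof (intro impI ballI)
      fix j :: nat assume j: "j \<in> {1,2}" and c: "\<epsilon> / real n \<le> cmod (coeff n)"
      have "\<epsilon> / 2 / real n < \<epsilon> / real n" using \<epsilon> elim(3) by (simp add: field_simps)
      then have gap: "\<epsilon> / 2 / real n < cmod (fourier_coeff q (2 * int n + 1))"
        using c by (simp add: coeff_def)
      have "is_eigenvalue q (of_real (mu n j))"
        using mu elim(2) j unfolding large_eigenvalues_def by blast
      then show "simple_eigenvalue q (of_real (mu n j))"
        using elim(1) j by (intro eigenvalue_simple[OF q _ gap, where \<delta> = "shift n j"]) blast+
    qed
  qed
qed

text \<open>When the coefficient is of order at least \<open>1 / n\<close>, the two eigenvalues are simple, hence distinct, and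
their eigenfunctions are orthogonal; therefore they cannot both follow the same branch
\<open>cmod c\<close> or \<open>- cmod c\<close>.\<close>

lemma shifts_opposite:
  assumes \<epsilon>: "\<epsilon> > 0"
  shows "\<forall>\<^sub>F n in sequentially. \<epsilon> / real n \<le> cmod (coeff n) \<longrightarrow> shift n 1 * shift n 2 \<le> 0"
proof -
  \<comment> \<open>\<open>\<epsilon> / 100\<close> makes the secular error at most a hundredth of the coefficient; \<open>1 / 30\<close> makes the orthogonality defect \<open>3 * \<theta>\<close> at most a tenth.\<close>
  define \<theta> where "\<theta> = min (\<epsilon> / 100) (1 / 30)"
  have \<theta>: "\<theta> > 0" "\<theta> \<le> \<epsilon> / 100" "\<theta> \<le> 1 / 30" using \<epsilon> by (auto simp: \<theta>_def)
  from eventually_secular_estimate[OF \<theta>(1)] eventually_simple[OF \<epsilon>] eventually_ge_at_top[of N0] eventually_gt_at_top[of 0]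
  show ?thesis
  proof eventually_elim
    case (elim n)
    show ?case
    proof
      assume c: "\<epsilon> / real n \<le> cmod (coeff n)"
      have "mu n 1 \<noteq> mu n 2"
        using elim(2) c by (intro simple_eigenvalues_distinct[OF mu elim(3) _ eigenvalues_unbounded]) auto
      obtain y u x where y: "antiperiodic_solution q (mu n 1) y u" "x \<in> {0..1}" "y x \<noteq> 0"
        using eigenfunction_exists[OF elim(3), of 1] by auto
      obtain z v x' where z: "antiperiodic_solution q (mu n 2) z v" "x' \<in> {0..1}" "z x' \<noteq> 0"
        using eigenfunction_exists[OF elim(3), of 2] by auto
      have ey: "secular_estimate q n \<theta> (shift n 1) y u" and ez: "secular_estimate q n \<theta> (shift n 2) z v"
        using elim(1) y(1) z(1) by blast+
      note Vy = secular_estimate_nontrivial[OF ey y(2,3)] and Vz = secular_estimate_nontrivial[OF ez z(2,3)]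
      note dy = secular_estimate_abs[OF ey Vy, folded coeff_def] and dz = secular_estimate_abs[OF ez Vz, folded coeff_def]
      note ey' = ey[unfolded secular_estimate_def Let_def, folded coeff_def]
      note ez' = ez[unfolded secular_estimate_def Let_def, folded coeff_def]
      have near: "cmod (amplitude (freq n) y u 0 * cnj (amplitude (freq n) z v 0)
            + amplitude (- freq n) y u 0 * cnj (amplitude (- freq n) z v 0))
          \<le> 3 * \<theta> * ((cmod (amplitude (freq n) y u 0) + cmod (amplitude (- freq n) y u 0))
                   * (cmod (amplitude (freq n) z v 0) + cmod (amplitude (- freq n) z v 0)))"
        using ey' ez' \<theta> freq_pos[of n]
        by (intro near_orthogonal_amplitudes[OF y(1) z(1) \<open>mu n 1 \<noteq> mu n 2\<close> cis_freq]) auto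
      have orth: "cmod (amplitude (freq n) y u 0 * cnj (amplitude (freq n) z v 0)
            + amplitude (- freq n) y u 0 * cnj (amplitude (- freq n) z v 0))
          \<le> (cmod (amplitude (freq n) y u 0) + cmod (amplitude (- freq n) y u 0))
                   * (cmod (amplitude (freq n) z v 0) + cmod (amplitude (- freq n) z v 0)) / 10"
        by (rule order_trans[OF near order_trans[OF mult_right_mono[of _ "1/10"]]]) (use \<theta> in auto)
      have "0 < \<epsilon> / real n" using \<epsilon> elim(4) by simp
      then have k: "coeff n \<noteq> 0" using c by auto
      have "100 * (\<theta> / real n) \<le> \<epsilon> / real n" using \<theta>(2) elim(4) by (simp add: field_simps)
      then have t: "100 * (\<theta> / real n) \<le> cmod (coeff n)" using c by simp
      show "shift n 1 * shift n 2 \<le> 0"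
        by (rule opposite_signs_of_near_orthogonal[OF Vy Vz k _ t dy dz _ _ _ _ orth])
          (use ey' ez' \<theta> in auto)
    qed
  qed
qed

text \<open>A bound by half the coefficient excludes the value 0 for both shifts; being ordered and of opposite
signs, they are then negative and positive respectively, and \<open>shift_abs\<close> gives their size.\<close>

lemma shift_signed:
  assumes \<epsilon>: "\<epsilon> > 0" and \<eta>: "\<eta> > 0"
  shows "\<forall>\<^sub>F n in sequentially. \<epsilon> / real n \<le> cmod (coeff n) \<longrightarrow>
           (\<forall>j\<in>{1,2}. \<bar>shift n j - (-1) ^ j * cmod (coeff n)\<bar> \<le> \<eta> / real n)"
proof -
  have "\<epsilon> / 2 > 0" using \<epsilon> by simp
  from shift_abs[OF this] shift_abs[OF \<eta>] shifts_opposite[OF \<epsilon>] eventually_ge_at_top[of N0] eventually_gt_at_top[of 0]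
  show ?thesis
  proof eventually_elim
    case (elim n)
    show ?case
    proof
      assume c: "\<epsilon> / real n \<le> cmod (coeff n)"
      have "\<epsilon> / 2 / real n < \<epsilon> / real n" using \<epsilon> elim(5) by (simp add: field_simps)
      moreover have "\<bar>\<bar>shift n 1\<bar> - cmod (coeff n)\<bar> \<le> \<epsilon> / 2 / real n" "\<bar>\<bar>shift n 2\<bar> - cmod (coeff n)\<bar> \<le> \<epsilon> / 2 / real n"
        using elim(1) by auto
      ultimately have "shift n 1 \<noteq> 0" "shift n 2 \<noteq> 0" using c by auto
      moreover have "shift n 1 \<le> shift n 2"
        using mu elim(4) by (simp add: large_eigenvalues_def shift_def)
      moreover have "shift n 1 * shift n 2 \<le> 0" using elim(3) c by blast
      ultimately have "shift n 1 < 0" "0 < shift n 2"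
        by (auto simp: mult_le_0_iff)
      moreover have "\<bar>\<bar>shift n 1\<bar> - cmod (coeff n)\<bar> \<le> \<eta> / real n" "\<bar>\<bar>shift n 2\<bar> - cmod (coeff n)\<bar> \<le> \<eta> / real n"
        using elim(2) by auto
      ultimately show "\<forall>j\<in>{1,2}. \<bar>shift n j - (-1) ^ j * cmod (coeff n)\<bar> \<le> \<eta> / real n"
        by (simp add: power2_eq_square)
    qed
  qed
qed

end

theorem corollary2:
  fixes q :: "real \<Rightarrow> real" and \<mu> :: "nat \<Rightarrow> nat \<Rightarrow> real" and N0 :: nat
  assumes periodic: "\<And>x. q (x + 1) = q x"
    and L1: "q absolutely_integrable_on {0..1}"
    and mean_zero: "integral {0..1} q = 0"
    and eigenvalues: "large_eigenvalues q N0 \<mu>"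
  shows "((\<lambda>n. fourier_coeff q (2 * int n + 1)) \<in> o(\<lambda>n. 1 / of_nat n) \<longrightarrow>
            (\<forall>j\<in>{1,2}. (\<lambda>n. \<mu> n j - (2 * pi * real n + pi)\<^sup>2) \<in> o(\<lambda>n. 1 / real n))) \<and>
         (\<forall>\<epsilon>>0. \<forall>\<^sub>F N in sequentially.
            (\<forall>n\<in>N2_set q \<epsilon> N. \<forall>j\<in>{1,2}. simple_eigenvalue q (of_real (\<mu> n j))) \<and>
            (\<forall>j\<in>{1,2}.
               (\<lambda>n. \<mu> n j - ((2 * pi * real n + pi)\<^sup>2
                        + (-1) ^ j * cmod (fourier_coeff q (2 * int n + 1))))
                 \<in> o[inf sequentially (principal (N2_set q \<epsilon> N))](\<lambda>n. 1 / real n)))"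
proof -
  interpret antiperiodic_spectrum q N0 \<mu>
    using L1 mean_zero eigenvalues by unfold_locales
  show ?thesis
  proof (intro conjI impI allI)
    assume o: "(\<lambda>n. fourier_coeff q (2 * int n + 1)) \<in> o(\<lambda>n. 1 / of_nat n)"
    show "\<forall>j\<in>{1,2}. (\<lambda>n. \<mu> n j - (2 * pi * real n + pi)\<^sup>2) \<in> o(\<lambda>n. 1 / real n)"
    proof (intro ballI landau_o.smallI)
      fix j :: nat and \<eta> :: real assume j: "j \<in> {1,2}" and \<eta>: "\<eta> > 0"
      then have "\<eta> / 2 > 0" by simp
      from landau_o.smallD[OF o this] shift_abs[OF this]
      show "\<forall>\<^sub>F n in sequentially. norm (\<mu> n j - (2 * pi * real n + pi)\<^sup>2) \<le> \<eta> * norm (1 / real n)"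
      proof eventually_elim
        case (elim n)
        have "cmod (coeff n) \<le> \<eta> / 2 / real n"
          using elim(1) by (simp add: coeff_def norm_divide)
        moreover have "\<bar>\<bar>shift n j\<bar> - cmod (coeff n)\<bar> \<le> \<eta> / 2 / real n"
          using elim(2) j by blast
        ultimately have "\<bar>shift n j\<bar> \<le> \<eta> / 2 / real n + \<eta> / 2 / real n" by linarith
        then show ?case by (simp add: shift_def freq_square)
      qed
    qed
  next
    fix \<epsilon> :: real assume \<epsilon>: "\<epsilon> > 0"
    obtain M where M: "\<And>n. n \<ge> M \<Longrightarrow> \<epsilon> / real n \<le> cmod (coeff n) \<longrightarrow>
           (\<forall>j\<in>{1,2}. simple_eigenvalue q (of_real (\<mu> n j)))"
      using eventually_simple[OF \<epsilon>] by (auto simp: eventually_sequentially)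
    show "\<forall>\<^sub>F N in sequentially.
            (\<forall>n\<in>N2_set q \<epsilon> N. \<forall>j\<in>{1,2}. simple_eigenvalue q (of_real (\<mu> n j))) \<and>
            (\<forall>j\<in>{1,2}.
               (\<lambda>n. \<mu> n j - ((2 * pi * real n + pi)\<^sup>2
                        + (-1) ^ j * cmod (fourier_coeff q (2 * int n + 1))))
                 \<in> o[inf sequentially (principal (N2_set q \<epsilon> N))](\<lambda>n. 1 / real n))"
    proof (intro eventually_sequentiallyI[of M] conjI ballI landau_o.smallI)
      fix N n j :: nat assume "M \<le> N" "n \<in> N2_set q \<epsilon> N" "j \<in> {1,2}"
      then show "simple_eigenvalue q (of_real (\<mu> n j))"
        using M[of n] by (auto simp: N2_set_def coeff_def)
    next
      fix N j :: nat and \<eta> :: real assume j: "j \<in> {1,2}" and \<eta>: "\<eta> > 0"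
      show "\<forall>\<^sub>F n in inf sequentially (principal (N2_set q \<epsilon> N)).
          norm (\<mu> n j - ((2 * pi * real n + pi)\<^sup>2 + (-1) ^ j * cmod (fourier_coeff q (2 * int n + 1))))
            \<le> \<eta> * norm (1 / real n)"
        unfolding eventually_inf_principal
        using shift_signed[OF \<epsilon> \<eta>]
      proof eventually_elim
        case (elim n)
        show ?case
        proof
          assume "n \<in> N2_set q \<epsilon> N"
          then have "\<bar>shift n j - (-1) ^ j * cmod (coeff n)\<bar> \<le> \<eta> / real n"
            using elim j by (auto simp: N2_set_def coeff_def)
          then show "norm (\<mu> n j - ((2 * pi * real n + pi)\<^sup>2 + (-1) ^ j * cmod (fourier_coeff q (2 * int n + 1))))
            \<le> \<eta> * norm (1 / real n)"
            by (simp add: shift_def coeff_def freq_square diff_diff_add)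
        qed
      qed
    qed
  qed
qed

end
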